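(* Let $n>40$ be an integer and let $\mathcal H$ be a (not necessarily uniform) hypergraph on $n$ vertices, and let $d_1\leq d_2\leq \dots\leq d_n$ be the degrees of its vertices listed in nondecreasing order. Suppose that (1) $d_i>2^i$ for all $1\leq i\leq \lfloor\frac{n-1}{2}\rfloor$; (2) if $n$ is even, then $d_{\frac{n-2}{2}}>2^{\frac{n-2}{2}}+1$. Then $\mathcal H$ contains a Hamiltonian Berge cycle.
   Context: A hypergraph $\mathcal H$ consists of a finite vertex set $V(\mathcal H)$ and a set $E(\mathcal H)$ of distinct subsets of $V(\mathcal H)$ (of arbitrary sizes) called hyperedges; no hyperedge appears more than once. The degree $d(v)$ of a vertex $v$ is the number of hyperedges containing $v$. A Berge cycle of length $t$ is a sequence $v_1,e_1,v_2,e_2,\dots,v_t,e_t$ of $t$ distinct vertices and $t$ distinct hyperedges such that $\{v_i,v_{i+1}\}\subseteq e_i$ for all $i\in[t]$, indices modulo $t$. A Berge cycle is Hamiltonian if its vertices $v_1,\dots,v_t$ are all the vertices of $\mathcal H$ (i.e. $t=n$). *)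

theory Defs
  imports Main "HOL-Library.Multiset"
begin

definition hypergraph :: "'a set \<Rightarrow> 'a set set \<Rightarrow> bool" where
  "hypergraph V E \<longleftrightarrow> finite V \<and> (\<forall>e\<in>E. e \<subseteq> V)"

definition hdegree :: "'a set set \<Rightarrow> 'a \<Rightarrow> nat" where
  "hdegree E v = card {e \<in> E. v \<in> e}"

text \<open>Degrees listed in nondecreasing order; d_i (1-based) is element i-1.\<close>
definition degree_seq :: "'a set \<Rightarrow> 'a set set \<Rightarrow> nat list" where
  "degree_seq V E = sorted_list_of_multiset (image_mset (hdegree E) (mset_set V))"

definition sdeg :: "'a set \<Rightarrow> 'a set set \<Rightarrow> nat \<Rightarrow> nat" where
  "sdeg V E i = degree_seq V E ! (i - 1)"

definition berge_cycle :: "'a set set \<Rightarrow> 'a list \<Rightarrow> 'a set list \<Rightarrow> bool" where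
  "berge_cycle E vs es \<longleftrightarrow> length vs = length es \<and> length vs \<ge> 1 \<and>
     distinct vs \<and> distinct es \<and> set es \<subseteq> E \<and>
     (\<forall>i < length vs. {vs ! i, vs ! ((i + 1) mod length vs)} \<subseteq> es ! i)"

definition hamiltonian_berge_cycle :: "'a set \<Rightarrow> 'a set set \<Rightarrow> bool" where
  "hamiltonian_berge_cycle V E \<longleftrightarrow> (\<exists>vs es. berge_cycle E vs es \<and> set vs = V)"

end

theory Submission
  imports Defs
begin

text \<open>
  Take a counterexample with \<open>E\<close> maximal and a missing pair \<open>{u, v}\<close> with \<open>d(u) + d(v)\<close> maximal; a
  Hamiltonian Berge path joins \<open>u\<close> to \<open>v\<close>. Let \<open>p \<le> q\<close> be the numbers of neighbours of \<open>u\<close> and \<open>v\<close>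
  through hyperedges off the path. Let \<open>A\<close> be the set of positions \<open>i\<close> such that \<open>u\<close> is such a
  neighbour of \<open>v\<^sub>i\<^sub>+\<^sub>1\<close> or lies in the path edge \<open>e\<^sub>i\<close>. Then \<open>|A| + q < n\<close>, and the \<open>|A|\<close> vertices \<open>v\<^sub>i\<close> are
  not adjacent to \<open>v\<close>, hence have degree at most \<open>d(u)\<close>, so the hypothesis yields \<open>d(u) > 2\<^bsup>|A|\<^esup>\<close> as
  long as \<open>|A|\<close> is at most \<open>m = \<lfloor>(n - 1) / 2\<rfloor>\<close>. On the other hand \<open>d(u) \<le> 2\<^bsup>p\<^esup> + b\<close>, where \<open>b \<le> |A|\<close> counts the bad
  path edges, those through \<open>u\<close> not contained in \<open>{u} \<union> N(u)\<close>. This forces \<open>|A| = p\<close> and a bad path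
  edge, while all but fewer than \<open>p\<close> of the sets \<open>{u} \<union> S\<close> with \<open>S \<subseteq> N(u)\<close> are hyperedges off the
  path. This abundance allows rerouting the path with the same ends so that the bad edge becomes its
  first edge or leaves the path, and then \<open>|A| > p\<close>, a contradiction. Only \<open>n = 2m + 2\<close>,
  \<open>p = q = m\<close> leaves room for one more position in \<open>A\<close>; there condition (2) gives two bad edges at
  each end, one for \<open>u\<close> fills that position and one for \<open>v\<close> then closes a Hamiltonian cycle.
\<close>

section \<open>Set families missing few subsets\<close>

lemma card_supersets_in_Pow:
  assumes "finite N" "A \<subseteq> N"
  shows "card {S \<in> Pow N. A \<subseteq> S} = 2 ^ (card N - card A)"
proof -
  have "{S \<in> Pow N. A \<subseteq> S} = (\<lambda>S. S \<union> A) ` Pow (N - A)"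
  proof (intro set_eqI iffI)
    fix S assume "S \<in> {S \<in> Pow N. A \<subseteq> S}"
    then have "S = (S - A) \<union> A" "S - A \<in> Pow (N - A)" by auto
    then show "S \<in> (\<lambda>S. S \<union> A) ` Pow (N - A)" by (rule image_eqI)
  qed (use assms in auto)
  moreover have "inj_on (\<lambda>S. S \<union> A) (Pow (N - A))"
    by (auto simp: inj_on_def)
  ultimately show ?thesis
    using assms by (simp add: card_image card_Pow card_Diff_subset finite_subset)
qed

text \<open>At most \<open>card N - 1\<close> subsets of \<open>N\<close> are missing from
  \<open>T\<close>, fewer than the \<open>2 ^ (card N - 1)\<close> subsets through a point. If
  \<open>{x}\<close> is in \<open>T\<close>, it serves as \<open>F\<close>; otherwise
  \<open>{x}\<close> is a missing set avoiding every other \<open>z\<close>, which leaves room to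
  discard \<open>F\<close> as well.\<close>

lemma dense_family_swap:
  assumes N: "finite N" and T: "T \<subseteq> Pow N" "2 ^ card N + 1 \<le> card T + card N"
    and x: "x \<in> N"
  obtains F where "F \<in> T" "x \<in> F" "\<And>z. z \<in> N \<Longrightarrow> z \<noteq> x \<Longrightarrow> \<exists>G\<in>T. G \<noteq> F \<and> z \<in> G"
proof -
  define M where "M = Pow N - T"
  define H where "H z = {S \<in> Pow N. {z} \<subseteq> S}" for z
  have fin: "finite M" "finite T"
    using N T(1) by (auto simp: M_def intro: finite_subset)
  have p: "card N \<ge> 1"
    using x N by (metis One_nat_def Suc_leI card_gt_0_iff empty_iff)
  have M: "card M + 1 \<le> card N"
    using T N p by (simp add: M_def card_Diff_subset fin card_Pow)
  have H: "card (H z) = 2 ^ (card N - 1)" if "z \<in> N" for z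
    using card_supersets_in_Pow[OF N, of "{z}"] that by (simp add: H_def)
  have big: "card N \<le> 2 ^ (card N - 1)"
    using less_exp[of "card N - 1"] p by linarith
  have out: "\<not> H z \<subseteq> M" if "z \<in> N" for z
  proof
    assume "H z \<subseteq> M"
    then have "card (H z) \<le> card M" by (rule card_mono[OF fin(1)])
    then show False using H[OF that] M big by simp
  qed
  show ?thesis
  proof (cases "{x} \<in> T")
    case True
    show ?thesis
    proof (rule that[OF True])
      fix z assume "z \<in> N" "z \<noteq> x"
      then show "\<exists>G\<in>T. G \<noteq> {x} \<and> z \<in> G"
        using out[of z] by (auto simp: H_def M_def)
    qed simp
  next
    case False
    obtain F where F: "F \<in> T" "x \<in> F"
      using out[OF x] by (auto simp: H_def M_def)
    have "\<exists>G\<in>T. G \<noteq> F \<and> z \<in> G" if z: "z \<in> N" "z \<noteq> x" for z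
    proof (rule ccontr)
      assume "\<not> ?thesis"
      then have "H z \<subseteq> insert F (M - {{x}})"
        using z by (auto simp: H_def M_def)
      then have "card (H z) \<le> card (insert F (M - {{x}}))"
        by (rule card_mono[rotated]) (use fin in simp)
      also have "\<dots> \<le> Suc (card (M - {{x}}))"
        by (simp add: card_insert_if fin)
      also have "\<dots> = card M"
      proof -
        have "{x} \<in> M" using False x by (simp add: M_def)
        then show ?thesis by (rule card_Suc_Diff1[OF fin(1)])
      qed
      finally show False using H[OF z(1)] M big by simp
    qed
    with F show ?thesis by (rule that)
  qed
qed

text \<open>In the application \<open>S\<close> comes from a hyperedge on the path, hence is absent
  from \<open>T\<close>. It avoids \<open>y\<close> and every \<open>z\<close> in question, so at
  most \<open>card N - 2\<close> missing sets compete with the sets through \<open>x\<close> and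
  \<open>y\<close> or through \<open>z\<close>.\<close>

lemma dense_family_pair_swap:
  assumes N: "finite N" and T: "T \<subseteq> Pow N" "2 ^ card N + 1 \<le> card T + card N"
    and xy: "x \<in> N" "y \<in> N" and S: "S \<subseteq> N" "S \<notin> T" "x \<in> S" "y \<notin> S"
  obtains F where "F \<in> T" "x \<in> F" "y \<in> F"
    "\<And>z. z \<in> N - S \<Longrightarrow> \<exists>G\<in>T. G \<noteq> F \<and> z \<in> G"
proof -
  define M where "M = Pow N - T - {S}"
  have fin: "finite M" "finite T"
    using N T(1) by (auto simp: M_def intro: finite_subset)
  have neq: "x \<noteq> y" using S by auto
  have p: "card N \<ge> 2"
    using card_mono[OF N, of "{x, y}"] xy neq by simp
  have M: "card M + 2 \<le> card N"
  proof -
    have "card (Pow N - T) = Suc (card M)"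
      unfolding M_def by (rule card_Suc_Diff1[symmetric]) (use S N in auto)
    then show ?thesis
      using T N by (simp add: card_Diff_subset fin card_Pow)
  qed
  have "\<not> {R \<in> Pow N. {x, y} \<subseteq> R} \<subseteq> M"
  proof
    assume "{R \<in> Pow N. {x, y} \<subseteq> R} \<subseteq> M"
    then have "card {R \<in> Pow N. {x, y} \<subseteq> R} \<le> card M"
      by (rule card_mono[OF fin(1)])
    then have "2 ^ (card N - card {x, y}) \<le> card M"
      using card_supersets_in_Pow[OF N, of "{x, y}"] xy by simp
    moreover have "card {x, y} = 2" using neq by simp
    ultimately have "2 ^ (card N - 2) \<le> card M" by simp
    then show False
      using M less_exp[of "card N - 2"] by linarith
  qed
  then obtain F where F: "F \<in> T" "x \<in> F" "y \<in> F"
    using S by (auto simp: M_def)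
  have "\<exists>G\<in>T. G \<noteq> F \<and> z \<in> G" if z: "z \<in> N - S" for z
  proof (rule ccontr)
    assume "\<not> ?thesis"
    then have "{R \<in> Pow N. {z} \<subseteq> R} \<subseteq> insert F M"
      using z by (auto simp: M_def)
    then have "card {R \<in> Pow N. {z} \<subseteq> R} \<le> card (insert F M)"
      by (rule card_mono[rotated]) (use fin in simp)
    also have "\<dots> \<le> Suc (card M)"
      by (simp add: card_insert_if fin)
    finally have "2 ^ (card N - 1) \<le> Suc (card M)"
      using card_supersets_in_Pow[OF N, of "{z}"] z by simp
    then show False
      using M less_exp[of "card N - 1"] by linarith
  qed
  with F show ?thesis by (rule that)
qed

text \<open>For \<open>card N \<ge> 4\<close> the subsets through \<open>x\<close> and
  \<open>y\<close>, at least \<open>2 ^ (card N - 2)\<close> in number, outnumber the missing ones.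
  The case \<open>x = y\<close> is included because it occurs in the balanced case.\<close>

lemma dense_family_pair:
  assumes N: "finite N" and T: "T \<subseteq> Pow N" "2 ^ card N + 1 \<le> card T + card N"
    and "4 \<le> card N" and xy: "x \<in> N" "y \<in> N"
  obtains F where "F \<in> T" "x \<in> F" "y \<in> F"
proof -
  have fin: "finite (Pow N - T)" "finite T"
    using N T(1) by (auto intro: finite_subset)
  have grow: "k + 4 \<le> 2 ^ (k + 2)" for k :: nat
    by (induction k) auto
  have M: "card (Pow N - T) + 1 \<le> card N"
    using T N \<open>4 \<le> card N\<close> by (simp add: card_Diff_subset fin card_Pow)
  have "\<not> {R \<in> Pow N. {x, y} \<subseteq> R} \<subseteq> Pow N - T"
  proof
    assume "{R \<in> Pow N. {x, y} \<subseteq> R} \<subseteq> Pow N - T"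
    then have "card {R \<in> Pow N. {x, y} \<subseteq> R} \<le> card (Pow N - T)"
      by (rule card_mono[OF fin(1)])
    then have "2 ^ (card N - card {x, y}) \<le> card (Pow N - T)"
      using card_supersets_in_Pow[OF N, of "{x, y}"] xy by simp
    moreover have "(2::nat) ^ (card N - 2) \<le> 2 ^ (card N - card {x, y})"
      by (rule power_increasing) (auto simp: card_insert_if)
    moreover have "card N \<le> 2 ^ (card N - 2)"
    proof -
      obtain k where "card N = k + 4"
        using \<open>4 \<le> card N\<close> by (metis add.commute le_add_diff_inverse)
      then show ?thesis using grow[of k] by (simp add: power_add)
    qed
    ultimately show False using M by linarith
  qed
  then show ?thesis using that by auto
qed

section \<open>Berge paths\<close>

text \<open>Only incidence is recorded; distinctness belongs to \<open>ham_path\<close>. This lets a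
  cycle be written with its first vertex repeated at the end.\<close>

fun links :: "'a list \<Rightarrow> 'a set list \<Rightarrow> bool" where
  "links [x] [] \<longleftrightarrow> True"
| "links (x # y # xs) (e # es) \<longleftrightarrow> x \<in> e \<and> y \<in> e \<and> links (y # xs) es"
| "links _ _ \<longleftrightarrow> False"

lemma links_length: "links xs es \<Longrightarrow> length xs = Suc (length es)"
  by (induction xs es rule: links.induct) auto

lemma links_append:
  "length xs = Suc (length es) \<Longrightarrow> ys \<noteq> [] \<Longrightarrow>
    links (xs @ ys) (es @ f # fs) \<longleftrightarrow>
      links xs es \<and> last xs \<in> f \<and> hd ys \<in> f \<and> links ys fs"
proof (induction xs es rule: links.induct)
  case (1 x)
  then show ?case by (cases ys) auto
qed auto

lemma links_glue: "links (xs @ [a]) es \<Longrightarrow> links (a # ys) fs \<Longrightarrow> links (xs @ a # ys) (es @ fs)"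
proof (induction es arbitrary: xs)
  case Nil
  then show ?case by (cases xs) (auto dest: links_length)
next
  case (Cons e es)
  then obtain x xs' where "xs = x # xs'"
    by (cases xs) (auto dest: links_length)
  with Cons.prems Cons.IH[of xs'] show ?case by (cases xs') auto
qed

lemma links_rev: "links xs es \<Longrightarrow> links (rev xs) (rev es)"
proof (induction xs es rule: links.induct)
  case (2 x y xs e es)
  then have "links ((rev xs @ [y]) @ [x]) (rev es @ e # [])"
    by (subst links_append) (auto dest: links_length)
  then show ?case by simp
qed auto

lemma links_nth: "links xs es \<Longrightarrow> i < length es \<Longrightarrow> xs ! i \<in> es ! i \<and> xs ! Suc i \<in> es ! i"
proof (induction xs es arbitrary: i rule: links.induct)
  case (2 x y xs e es)
  then show ?case by (cases i) auto
qed auto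

lemma links_iff_nth:
  "links xs es \<longleftrightarrow>
    length xs = Suc (length es) \<and> (\<forall>i < length es. xs ! i \<in> es ! i \<and> xs ! Suc i \<in> es ! i)"
proof (induction xs es rule: links.induct)
  case (2 x y xs e es)
  then show ?case by (auto simp: All_less_Suc2)
qed auto

lemma links_split:
  assumes "links vs es" "i < length es"
  obtains xs ys as e bs where "vs = xs @ ys" "es = as @ e # bs" "es ! i = e" "length xs = Suc i"
    "length as = i" "links xs as" "links ys bs" "last xs = vs ! i" "hd ys = vs ! Suc i"
    "xs \<noteq> []" "ys \<noteq> []"
proof -
  let ?xs = "take (Suc i) vs" and ?ys = "drop (Suc i) vs"
  let ?as = "take i es" and ?bs = "drop (Suc i) es"
  have len: "length vs = Suc (length es)" using assms(1) by (rule links_length)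
  have vs: "vs = ?xs @ ?ys" and es: "es = ?as @ es ! i # ?bs"
    using assms(2) by (auto simp: id_take_nth_drop)
  have "links (?xs @ ?ys) (?as @ es ! i # ?bs)"
    using assms(1) vs es by simp
  then have "links ?xs ?as" "links ?ys ?bs"
    by (subst (asm) links_append; use assms(2) len in simp)+
  moreover have "last ?xs = vs ! i"
    using assms(2) len by (simp add: take_Suc_conv_app_nth)
  moreover have "hd ?ys = vs ! Suc i"
    using assms(2) len by (simp add: hd_drop_conv_nth)
  ultimately show ?thesis
    by (intro that[OF vs es refl]) (use assms(2) len in auto)
qed

definition ham_path :: "'a set \<Rightarrow> 'a set set \<Rightarrow> 'a list \<Rightarrow> 'a set list \<Rightarrow> bool" where
  "ham_path V E vs es \<longleftrightarrow>
    distinct vs \<and> set vs = V \<and> distinct es \<and> set es \<subseteq> E \<and> links vs es"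

section \<open>Unused hyperedges at the ends of a Hamiltonian path\<close>

definition spare :: "'a set set \<Rightarrow> 'a set list \<Rightarrow> 'a \<Rightarrow> 'a set set" where
  "spare E es x = {f \<in> E - set es. x \<in> f}"

text \<open>Adjacency counts only hyperedges off the path, so that they are free to close or reroute it.\<close>

definition nbrs :: "'a set set \<Rightarrow> 'a set list \<Rightarrow> 'a \<Rightarrow> 'a set" where
  "nbrs E es x = \<Union> (spare E es x) - {x}"

definition used :: "'a set list \<Rightarrow> 'a \<Rightarrow> nat set" where
  "used es x = {i. i < length es \<and> x \<in> es ! i}"

text \<open>A position \<open>i\<close> stands for the path edge between \<open>vs ! i\<close> and \<open>vs ! Suc i\<close>.\<close>

definition preds :: "'a set set \<Rightarrow> 'a list \<Rightarrow> 'a set list \<Rightarrow> nat set" where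
  "preds E vs es = {i. i < length es \<and> vs ! Suc i \<in> nbrs E es (hd vs)}"

definition succs :: "'a set set \<Rightarrow> 'a list \<Rightarrow> 'a set list \<Rightarrow> nat set" where
  "succs E vs es = {i. i < length es \<and> vs ! i \<in> nbrs E es (last vs)}"

lemma ham_path_rev: "ham_path V E vs es \<Longrightarrow> ham_path V E (rev vs) (rev es)"
  by (simp add: ham_path_def links_rev)

lemma ham_path_length: "ham_path V E vs es \<Longrightarrow> length vs = Suc (length es)"
  by (simp add: ham_path_def links_length)

lemma ham_path_hd_nth: "ham_path V E vs es \<Longrightarrow> hd vs = vs ! 0"
  by (metis ham_path_length hd_conv_nth list.size(3) nat.distinct(1))

lemma ham_path_last_nth: "ham_path V E vs es \<Longrightarrow> last vs = vs ! length es"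
  by (metis diff_Suc_1 ham_path_length last_conv_nth list.size(3) nat.distinct(1))

lemma ham_path_ends:
  assumes "ham_path V E vs es" "es \<noteq> []"
  shows "hd vs \<in> V" "last vs \<in> V" "hd vs \<noteq> last vs"
proof -
  have len: "length vs = Suc (length es)" using assms(1) by (rule ham_path_length)
  then have "vs \<noteq> []" by auto
  then show "hd vs \<in> V" "last vs \<in> V"
    using assms(1) by (auto simp: ham_path_def)
  show "hd vs \<noteq> last vs"
    using assms len unfolding ham_path_hd_nth[OF assms(1)] ham_path_last_nth[OF assms(1)]
    by (subst nth_eq_iff_index_eq) (auto simp: ham_path_def)
qed

lemma spare_rev [simp]: "spare E (rev es) x = spare E es x"
  by (simp add: spare_def)

lemma nbrs_rev [simp]: "nbrs E (rev es) x = nbrs E es x"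
  by (simp add: nbrs_def)

lemma ham_path_nth:
  assumes "ham_path V E vs es" "i < length es"
  shows "vs ! i \<in> es ! i" "vs ! Suc i \<in> es ! i" "es ! i \<in> E"
  using assms links_nth[of vs es i] by (auto simp: ham_path_def)

section \<open>Closing and rotating a path; crossing positions\<close>

lemma hamiltonian_if_close_path:
  assumes P: "ham_path V E vs es" and f: "f \<in> E" "f \<notin> set es" "hd vs \<in> f" "last vs \<in> f"
  shows "hamiltonian_berge_cycle V E"
proof -
  have len: "length vs = Suc (length es)" using P by (rule ham_path_length)
  have "vs ! i \<in> (es @ [f]) ! i \<and> vs ! ((i + 1) mod length vs) \<in> (es @ [f]) ! i"
    if "i < length vs" for i
  proof (cases "i < length es")
    case True
    then show ?thesis
      using len ham_path_nth[OF P True] by (simp add: nth_append)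
  next
    case False
    then have "i = length es" using that len by simp
    then show ?thesis
      using f len ham_path_hd_nth[OF P] ham_path_last_nth[OF P] by (simp add: nth_append)
  qed
  then have "berge_cycle E vs (es @ [f])"
    using P f len by (auto simp: berge_cycle_def ham_path_def)
  then show ?thesis
    using P unfolding hamiltonian_berge_cycle_def ham_path_def by blast
qed

text \<open>A Posa rotation: the segment up to \<open>vs ! i\<close> is reversed and attached to
  \<open>vs ! Suc i\<close> through \<open>f\<close>. The choice \<open>f = es ! i\<close> is
  legitimate since the cut releases that hyperedge.\<close>

lemma ham_path_rotate:
  assumes P: "ham_path V E vs es" and i: "i < length es"
    and f: "f \<in> E" "f \<notin> set es \<or> f = es ! i" "hd vs \<in> f" "vs ! Suc i \<in> f"
  obtains ws fs where "ham_path V E ws fs" "hd ws = vs ! i" "last ws = last vs"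
    "set fs \<subseteq> insert f (set es)"
proof -
  have "links vs es" using P by (simp add: ham_path_def)
  from links_split[OF this i] obtain xs ys as e bs where
    split: "vs = xs @ ys" "es = as @ e # bs" "es ! i = e" "links xs as" "links ys bs"
      "last xs = vs ! i" "hd ys = vs ! Suc i" "xs \<noteq> []" "ys \<noteq> []"
    by metis
  have d: "distinct (xs @ ys)" "set (xs @ ys) = V" "distinct (as @ e # bs)"
    "set (as @ e # bs) \<subseteq> E"
    using P split(1,2) by (auto simp: ham_path_def)
  have "f \<notin> set as \<union> set bs"
    using f(2) split(2,3) d(3) by auto
  moreover have "hd vs = hd xs" "last vs = last ys"
    using split by (metis hd_append2, metis last_append)
  moreover have "links (rev xs @ ys) (rev as @ f # bs)"
    using split f \<open>hd vs = hd xs\<close>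
    by (subst links_append) (auto simp: links_rev links_length last_rev)
  ultimately have "ham_path V E (rev xs @ ys) (rev as @ f # bs)"
    using d f(1) by (auto simp: ham_path_def)
  moreover have "hd (rev xs @ ys) = vs ! i" "last (rev xs @ ys) = last vs"
    using split \<open>last vs = last ys\<close> by (auto simp: hd_append hd_rev)
  moreover have "set (rev as @ f # bs) \<subseteq> insert f (set es)"
    using split(2) by auto
  ultimately show ?thesis by (rule that)
qed

text \<open>Rotating through \<open>f\<close> makes \<open>vs ! i\<close> the first vertex, and
  \<open>g\<close> then closes the path. If \<open>f\<close> and \<open>g\<close> coincided, this
  hyperedge would already close the original path.\<close>

lemma no_crossing:
  assumes P: "ham_path V E vs es" and nonham: "\<not> hamiltonian_berge_cycle V E"
    and i: "i < length es"
    and f: "f \<in> E" "f \<notin> set es \<or> f = es ! i" "hd vs \<in> f" "vs ! Suc i \<in> f"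
    and g: "g \<in> E" "g \<notin> set es" "vs ! i \<in> g" "last vs \<in> g"
  shows False
proof -
  obtain ws fs where Q: "ham_path V E ws fs" "hd ws = vs ! i" "last ws = last vs"
    "set fs \<subseteq> insert f (set es)"
    using P i f by (rule ham_path_rotate)
  have "g \<noteq> f"
    using hamiltonian_if_close_path[OF P] nonham f(3) g by auto
  then have "g \<notin> set fs" using Q(4) g(2) by auto
  then show False
    using hamiltonian_if_close_path[OF Q(1)] Q nonham g by auto
qed

lemma preds_used_disjnt_succs:
  assumes P: "ham_path V E vs es" and nonham: "\<not> hamiltonian_berge_cycle V E"
  shows "(preds E vs es \<union> used es (hd vs)) \<inter> succs E vs es = {}"
proof (rule equals0I)
  fix i assume i: "i \<in> (preds E vs es \<union> used es (hd vs)) \<inter> succs E vs es"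
  then have "i < length es" by (auto simp: succs_def)
  moreover obtain f where "f \<in> E" "f \<notin> set es \<or> f = es ! i" "hd vs \<in> f" "vs ! Suc i \<in> f"
    using i ham_path_nth[OF P] by (auto simp: preds_def used_def nbrs_def spare_def)
  moreover obtain g where "g \<in> E" "g \<notin> set es" "vs ! i \<in> g" "last vs \<in> g"
    using i by (auto simp: succs_def nbrs_def spare_def)
  ultimately show False by (rule no_crossing[OF P nonham])
qed

lemma preds_rev:
  assumes P: "ham_path V E vs es"
  shows "preds E (rev vs) (rev es) = (\<lambda>i. length es - Suc i) ` succs E vs es"
proof (intro set_eqI iffI)
  have len: "length vs = Suc (length es)" using P by (rule ham_path_length)
  {
    fix i assume i: "i \<in> preds E (rev vs) (rev es)"
    then have "i < length es" by (simp add: preds_def)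
    moreover from this have "rev vs ! Suc i = vs ! (length es - Suc i)"
      using len by (simp add: rev_nth)
    ultimately have "length es - Suc i \<in> succs E vs es" "i = length es - Suc (length es - Suc i)"
      using i len by (auto simp: preds_def succs_def hd_rev)
    then show "i \<in> (\<lambda>i. length es - Suc i) ` succs E vs es" by blast
  next
    fix j assume "j \<in> (\<lambda>i. length es - Suc i) ` succs E vs es"
    then obtain i where i: "i \<in> succs E vs es" "j = length es - Suc i" by auto
    then have "i < length es" by (simp add: succs_def)
    moreover from this have "rev vs ! Suc j = vs ! i"
      using len i by (simp add: rev_nth Suc_diff_Suc)
    ultimately show "j \<in> preds E (rev vs) (rev es)"
      using i len by (auto simp: preds_def succs_def hd_rev)
  }
qed

section \<open>Counting positions and bounding degrees\<close>

lemma nbrs_subset: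
  assumes "hypergraph V E"
  shows "nbrs E es x \<subseteq> V - {x}"
  using assms by (auto simp: nbrs_def spare_def hypergraph_def)

lemma finite_nbrs: "hypergraph V E \<Longrightarrow> finite (nbrs E es x)"
  by (meson finite_Diff finite_subset hypergraph_def nbrs_subset)

lemma finite_edges: "hypergraph V E \<Longrightarrow> finite E"
  by (metis Pow_iff finite_Pow_iff finite_subset hypergraph_def subsetI)

lemma card_preds:
  assumes "hypergraph V E" and P: "ham_path V E vs es"
  shows "card (preds E vs es) = card (nbrs E es (hd vs))"
proof -
  have len: "length vs = Suc (length es)" using P by (rule ham_path_length)
  have d: "distinct vs" "set vs = V" using P by (auto simp: ham_path_def)
  have "nbrs E es (hd vs) \<subseteq> (\<lambda>i. vs ! Suc i) ` preds E vs es"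
  proof
    fix w assume w: "w \<in> nbrs E es (hd vs)"
    then have "w \<in> set vs" "w \<noteq> vs ! 0"
      using nbrs_subset[OF assms(1)] d ham_path_hd_nth[OF P] by auto
    then obtain k where "k < length vs" "w = vs ! k" "k \<noteq> 0"
      by (metis in_set_conv_nth)
    then show "w \<in> (\<lambda>i. vs ! Suc i) ` preds E vs es"
      using w len by (intro image_eqI[of _ _ "k - 1"]) (auto simp: preds_def)
  qed
  then have "nbrs E es (hd vs) = (\<lambda>i. vs ! Suc i) ` preds E vs es"
    by (auto simp: preds_def)
  moreover have "inj_on (\<lambda>i. vs ! Suc i) (preds E vs es)"
    using d(1) len by (auto simp: inj_on_def preds_def nth_eq_iff_index_eq)
  ultimately show ?thesis by (simp add: card_image)
qed

lemma card_succs: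
  assumes "hypergraph V E" and P: "ham_path V E vs es"
  shows "card (succs E vs es) = card (nbrs E es (last vs))"
proof -
  have "vs \<noteq> []" using ham_path_length[OF P] by auto
  moreover have "inj_on (\<lambda>i. length es - Suc i) (succs E vs es)"
    by (auto simp: inj_on_def succs_def)
  ultimately show ?thesis
    using card_preds[OF assms(1) ham_path_rev[OF P]] preds_rev[OF P]
    by (simp add: card_image hd_rev)
qed

lemma finite_positions [simp]: "finite (preds E vs es)" "finite (used es x)" "finite (succs E vs es)"
  by (simp_all add: preds_def used_def succs_def)

lemma card_preds_used_le:
  assumes "hypergraph V E" and P: "ham_path V E vs es"
    and nonham: "\<not> hamiltonian_berge_cycle V E"
  shows "card (preds E vs es \<union> used es (hd vs)) + card (nbrs E es (last vs)) \<le> length es"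
proof -
  have "card (preds E vs es \<union> used es (hd vs)) + card (succs E vs es)
      = card ((preds E vs es \<union> used es (hd vs)) \<union> succs E vs es)"
    by (rule card_Un_disjoint[symmetric]) (use preds_used_disjnt_succs[OF P nonham] in auto)
  also have "\<dots> \<le> card {..<length es}"
    by (rule card_mono) (auto simp: preds_def succs_def used_def)
  finally show ?thesis using card_succs[OF assms(1) P] by simp
qed

lemma zero_in_used:
  assumes "ham_path V E vs es" "es \<noteq> []"
  shows "0 \<in> used es (hd vs)"
  using assms ham_path_nth(1)[OF assms(1), of 0] ham_path_hd_nth[OF assms(1)]
  by (simp add: used_def)

lemma hdegree_eq:
  assumes "hypergraph V E" and P: "ham_path V E vs es"
  shows "hdegree E x = card (spare E es x) + card (used es x)"
proof -
  have fin: "finite E" using assms(1) by (rule finite_edges)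
  have d: "distinct es" "set es \<subseteq> E" using P by (auto simp: ham_path_def)
  have "{e \<in> E. x \<in> e} = spare E es x \<union> (!) es ` used es x"
    using d nth_mem[of _ es] by (fastforce simp: spare_def used_def in_set_conv_nth)
  moreover have "spare E es x \<inter> (!) es ` used es x = {}"
    by (auto simp: spare_def used_def)
  moreover have "card ((!) es ` used es x) = card (used es x)"
    using d by (intro card_image) (auto simp: inj_on_def used_def nth_eq_iff_index_eq)
  ultimately show ?thesis
    using fin by (simp add: hdegree_def card_Un_disjoint spare_def)
qed

text \<open>Deleting the common point \<open>x\<close> from the spare hyperedges is injective and
  yields a family on \<open>nbrs E es x\<close>, to which the density lemmas apply.\<close>

lemma spare_family:
  assumes "hypergraph V E"
  shows "(\<lambda>f. f - {x}) ` spare E es x \<subseteq> Pow (nbrs E es x)"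
    "card ((\<lambda>f. f - {x}) ` spare E es x) = card (spare E es x)"
    "F \<in> (\<lambda>f. f - {x}) ` spare E es x \<Longrightarrow> insert x F \<in> spare E es x"
proof -
  show "(\<lambda>f. f - {x}) ` spare E es x \<subseteq> Pow (nbrs E es x)"
    by (auto simp: nbrs_def)
  show "card ((\<lambda>f. f - {x}) ` spare E es x) = card (spare E es x)"
    by (rule card_image) (auto simp: inj_on_def spare_def)
  show "F \<in> (\<lambda>f. f - {x}) ` spare E es x \<Longrightarrow> insert x F \<in> spare E es x"
    by (auto simp: spare_def insert_absorb)
qed

text \<open>Off-path hyperedges through \<open>x\<close> lie in
  \<open>insert x (nbrs E es x)\<close> by the definition of \<open>nbrs\<close>, so every hyperedge
  through \<open>x\<close> that leaves this set sits at a used position.\<close>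

lemma hdegree_le:
  assumes H: "hypergraph V E" and P: "ham_path V E vs es"
  shows "hdegree E x \<le>
    2 ^ card (nbrs E es x) + card {i \<in> used es x. \<not> es ! i \<subseteq> insert x (nbrs E es x)}"
proof -
  let ?N = "nbrs E es x"
  let ?bad = "{i \<in> used es x. \<not> es ! i \<subseteq> insert x ?N}"
  have fin: "finite ?N" "finite E" using H by (auto intro: finite_nbrs finite_edges)
  have d: "distinct es" "set es \<subseteq> E" using P by (auto simp: ham_path_def)
  have "{e \<in> E. x \<in> e} \<subseteq> insert x ` Pow ?N \<union> (!) es ` ?bad"
  proof
    fix e assume e: "e \<in> {e \<in> E. x \<in> e}"
    show "e \<in> insert x ` Pow ?N \<union> (!) es ` ?bad"
    proof (cases "e - {x} \<subseteq> ?N")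
      case True
      then have "e = insert x (e - {x})" using e by auto
      then show ?thesis using True by blast
    next
      case False
      then have "e \<in> set es" using e by (auto simp: nbrs_def spare_def)
      then obtain i where "i < length es" "e = es ! i" by (auto simp: in_set_conv_nth)
      then have "i \<in> ?bad" "e = es ! i" using False e by (auto simp: used_def)
      then show ?thesis by blast
    qed
  qed
  then have "hdegree E x \<le> card (insert x ` Pow ?N \<union> (!) es ` ?bad)"
    unfolding hdegree_def by (rule card_mono[rotated]) (use fin in simp)
  also have "\<dots> \<le> card (insert x ` Pow ?N) + card ((!) es ` ?bad)"
    by (rule card_Un_le)
  also have "\<dots> \<le> card (Pow ?N) + card ?bad"
    by (intro add_mono card_image_le) (use fin in auto)
  finally show ?thesis using fin by (simp add: card_Pow)
qed

section \<open>Rerouting a Hamiltonian path\<close>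

text \<open>Only \<open>f\<close> can become newly used, and it was not among the spare hyperedges
  at \<open>v\<close>.\<close>

lemma nbrs_mono_if_not_mem:
  assumes "set fs \<subseteq> insert f (set es)" "f \<in> set es \<or> v \<notin> f"
  shows "nbrs E es v \<subseteq> nbrs E fs v"
  using assms by (auto simp: nbrs_def spare_def)

lemma spare_not_closing:
  assumes "ham_path V E vs es" "\<not> hamiltonian_berge_cycle V E" "f \<in> spare E es (hd vs)"
  shows "last vs \<notin> f"
  using hamiltonian_if_close_path[OF assms(1)] assms by (auto simp: spare_def)

lemma last_not_in_nbrs_hd:
  assumes "ham_path V E vs es" "\<not> hamiltonian_berge_cycle V E"
  shows "last vs \<notin> nbrs E es (hd vs)" "hd vs \<notin> nbrs E es (last vs)"
  using hamiltonian_if_close_path[OF assms(1)] assms(2) by (auto simp: nbrs_def spare_def)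

text \<open>The first hyperedge is replaced by a spare \<open>f\<close> through \<open>hd vs\<close>
  and \<open>vs ! 1\<close>. Density gives an \<open>f\<close> whose loss hides no neighbour except
  possibly \<open>vs ! 1\<close>; the released bad hyperedge covers that one and adds a vertex
  outside the old neighbourhood.\<close>

lemma enlarge_nbrs_swap_first:
  assumes H: "hypergraph V E" and P: "ham_path V E vs es"
    and nonham: "\<not> hamiltonian_berge_cycle V E"
    and dense: "2 ^ card (nbrs E es (hd vs)) + 1
      \<le> card (spare E es (hd vs)) + card (nbrs E es (hd vs))"
    and es: "es \<noteq> []" and snd: "vs ! 1 \<in> nbrs E es (hd vs)"
    and bad: "\<not> es ! 0 \<subseteq> insert (hd vs) (nbrs E es (hd vs))"
  obtains fs where "ham_path V E vs fs" "nbrs E es (hd vs) \<subset> nbrs E fs (hd vs)"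
    "nbrs E es (last vs) \<subseteq> nbrs E fs (last vs)"
proof -
  let ?u = "hd vs" and ?N = "nbrs E es (hd vs)"
  let ?T = "(\<lambda>f. f - {?u}) ` spare E es ?u"
  obtain F where F: "F \<in> ?T" "vs ! 1 \<in> F"
    "\<And>z. z \<in> ?N \<Longrightarrow> z \<noteq> vs ! 1 \<Longrightarrow> \<exists>G\<in>?T. G \<noteq> F \<and> z \<in> G"
    using dense_family_swap[OF finite_nbrs[OF H] spare_family(1)[OF H] _ snd]
      dense spare_family(2)[OF H] by metis
  define f where "f = insert ?u F"
  have f: "f \<in> spare E es ?u" "f - {?u} = F"
    using spare_family(3)[OF H F(1)] F(1) by (auto simp: f_def)
  obtain e es' where es': "es = e # es'" using es by (cases es) auto
  have "length vs = Suc (length es)" using P by (rule ham_path_length)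
  then obtain u y ws where vs: "vs = u # y # ws"
    using es' by (cases vs; cases "tl vs") auto
  have Q: "ham_path V E vs (f # es')"
    using P f(1) F(2) unfolding vs es' by (auto simp: ham_path_def spare_def f_def)
  have e: "e \<in> spare E (f # es') u" "y \<in> e"
    using P f(1) unfolding vs es' by (auto simp: ham_path_def spare_def)
  have "z \<in> nbrs E (f # es') u" if z: "z \<in> ?N" for z
  proof (cases "z = y")
    case True
    then show ?thesis using e z vs by (auto simp: nbrs_def)
  next
    case False
    then obtain g where "g \<in> spare E es ?u" "g - {?u} \<noteq> F" "z \<in> g"
      using F(3)[OF z] vs by auto
    then have "g \<in> spare E (f # es') u"
      using f(2) es' vs by (auto simp: spare_def)
    then show ?thesis using \<open>z \<in> g\<close> z vs by (auto simp: nbrs_def)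
  qed
  moreover obtain w where "w \<in> e" "w \<noteq> u" "w \<notin> ?N" using bad vs es' by auto
  moreover from this have "w \<in> nbrs E (f # es') u" using e by (auto simp: nbrs_def)
  ultimately have "?N \<subset> nbrs E (f # es') ?u" using vs by auto
  moreover have "nbrs E es (last vs) \<subseteq> nbrs E (f # es') (last vs)"
    using spare_not_closing[OF P nonham f(1)] es'
    by (intro nbrs_mono_if_not_mem) auto
  ultimately show ?thesis using that Q by blast
qed

text \<open>The path \<open>u, v\<^sub>1, \<dots>, v\<^sub>i, v\<^sub>i\<^sub>+\<^sub>1, \<dots>\<close> becomes \<open>u, v\<^sub>i, \<dots>, v\<^sub>1, v\<^sub>i\<^sub>+\<^sub>1, \<dots>\<close>; the new first
  hyperedge is the old \<open>es ! i\<close>, and \<open>es ! 0\<close> is released, either for the step from \<open>v\<^sub>1\<close> to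
  \<open>v\<^sub>i\<^sub>+\<^sub>1\<close> or, if it misses \<open>v\<^sub>i\<^sub>+\<^sub>1\<close>, as a replacement for the spare hyperedge used there.\<close>

lemma rotate_edge_to_front:
  assumes H: "hypergraph V E" and P: "ham_path V E vs es"
    and nonham: "\<not> hamiltonian_berge_cycle V E"
    and dense: "2 ^ card (nbrs E es (hd vs)) + 1
      \<le> card (spare E es (hd vs)) + card (nbrs E es (hd vs))"
    and snd: "vs ! 1 \<in> nbrs E es (hd vs)"
    and first: "es ! 0 \<subseteq> insert (hd vs) (nbrs E es (hd vs))"
    and i: "0 < i" "i < length es" "hd vs \<in> es ! i" "vs ! Suc i \<in> nbrs E es (hd vs)"
  obtains ws fs where "ham_path V E ws fs" "hd ws = hd vs" "last ws = last vs"
    "ws ! 1 = vs ! i" "fs ! 0 = es ! i"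
    "nbrs E es (hd vs) \<subseteq> nbrs E fs (hd vs)"
    "nbrs E es (last vs) \<subseteq> nbrs E fs (last vs)"
    "card (spare E fs (hd vs)) = card (spare E es (hd vs))"
proof -
  let ?N = "nbrs E es (hd vs)"
  have len: "length vs = Suc (length es)" using P by (rule ham_path_length)
  obtain e0 es' where es': "es = e0 # es'" using i(2) by (cases es) auto
  obtain u vs' where vs': "vs = u # vs'" using len by (cases vs) auto
  have L: "links vs' es'" "u \<in> e0"
    using P unfolding vs' es' ham_path_def by (cases vs'; auto)+
  obtain xs ys as e bs where split: "vs' = xs @ ys" "es' = as @ e # bs" "es' ! (i - 1) = e"
      "links xs as" "links ys bs" "last xs = vs' ! (i - 1)" "hd ys = vs' ! Suc (i - 1)"
      "xs \<noteq> []" "ys \<noteq> []"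
  proof -
    have "i - 1 < length es'" using i es' by simp
    then show ?thesis using links_split[OF L(1)] that by metis
  qed
  define x y where "x = hd xs" and "y = hd ys"
  have x: "x = vs ! 1" and y: "y = vs ! Suc i" and li: "last xs = vs ! i" and ei: "e = es ! i"
    using split(1-3,6-9) i vs' es' by (auto simp: x_def y_def hd_append hd_conv_nth nth_append)
  have D: "distinct (u # xs @ ys)" "set (u # xs @ ys) = V" "distinct (e0 # as @ e # bs)"
    "set (e0 # as @ e # bs) \<subseteq> E"
    using P unfolding ham_path_def vs' es' split(1,2) by auto
  have xy: "x \<in> ?N" "y \<in> ?N" "x \<noteq> u" "y \<noteq> u" "x \<in> e0" "u \<in> e" "last xs \<in> e"
    using snd i(2,3,4) x y vs' ham_path_nth[OF P, of 0] ham_path_nth(1)[OF P i(2)] es' li ei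
    by (auto simp: nbrs_def)
  obtain f where f: "f \<in> E" "f \<notin> set es - {e0}" "x \<in> f" "y \<in> f" "u \<in> f"
    "?N \<subseteq> nbrs E (e # rev as @ f # bs) u"
  proof (cases "y \<in> e0")
    case True
    have "?N \<subseteq> nbrs E (e # rev as @ e0 # bs) u"
      using vs' es' split(2) by (auto simp: nbrs_def spare_def)
    then show ?thesis using that[of e0] True xy D L(2) es' by auto
  next
    case False
    let ?T = "(\<lambda>f. f - {u}) ` spare E es u"
    have S: "e0 - {u} \<subseteq> ?N" "x \<in> e0 - {u}" "y \<notin> e0 - {u}"
      using first es' vs' xy False by auto
    have nS: "e0 - {u} \<notin> ?T"
    proof
      assume "e0 - {u} \<in> ?T"
      then have "insert u (e0 - {u}) \<in> spare E es u" by (rule spare_family(3)[OF H])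
      then show False using L(2) es' by (auto simp: spare_def insert_absorb)
    qed
    have T: "?T \<subseteq> Pow ?N" "2 ^ card ?N + 1 \<le> card ?T + card ?N"
      using spare_family(1,2)[OF H, of u es] dense vs' by simp_all
    obtain F where F: "F \<in> ?T" "x \<in> F" "y \<in> F"
      "\<And>z. z \<in> ?N - (e0 - {u}) \<Longrightarrow> \<exists>G\<in>?T. G \<noteq> F \<and> z \<in> G"
      by (rule dense_family_pair_swap[OF finite_nbrs[OF H] T xy(1,2) S(1) nS S(2,3)]) blast
    define f where "f = insert u F"
    have f: "f \<in> spare E es u" "f - {u} = F"
      using spare_family(3)[OF H F(1)] F(1) by (auto simp: f_def)
    \<comment> \<open>Neighbours inside \<open>e0\<close> are seen through \<open>e0\<close>, which
      is off the new path since \<open>y\<close> lies in \<open>f\<close> but not in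
      \<open>e0\<close>; the others through a spare hyperedge different from
      \<open>f\<close>.\<close>
    have "z \<in> nbrs E (e # rev as @ f # bs) u" if z: "z \<in> ?N" for z
    proof (cases "z \<in> e0")
      case True
      have "e0 \<in> spare E (e # rev as @ f # bs) u"
        using D F(3) \<open>y \<notin> e0 - {u}\<close> F(3) xy L(2) False \<open>y \<in> F\<close>
        by (auto simp: spare_def f_def)
      then show ?thesis using True z vs' by (auto simp: nbrs_def)
    next
      case False
      then obtain g where "g \<in> spare E es u" "g - {u} \<noteq> F" "z \<in> g"
        using F(4)[of z] z by auto
      then have "g \<in> spare E (e # rev as @ f # bs) u"
        using f(2) es' split(2) by (auto simp: spare_def)
      then show ?thesis using \<open>z \<in> g\<close> z vs' by (auto simp: nbrs_def)
    qed
    then show ?thesis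
      using that[of f] f(1) F(2,3) by (auto simp: spare_def f_def)
  qed
  define ws fs where "ws = u # rev xs @ ys" and "fs = e # rev as @ f # bs"
  have fnot: "f \<notin> set as" "f \<notin> set bs" "f \<noteq> e"
    using f(2) D(3) unfolding es' split(2) by auto
  have "links (rev xs @ ys) (rev as @ f # bs)"
    using split f(3,4) x_def y_def
    by (subst links_append) (auto simp: links_rev links_length last_rev)
  then have "links ws fs"
    unfolding ws_def fs_def
    using xy(6,7) split(8) by (cases xs rule: rev_cases) auto
  then have Q: "ham_path V E ws fs"
    using D f(1) fnot by (auto simp: ham_path_def ws_def fs_def)
  have "set fs \<subseteq> insert f (set es)"
    unfolding fs_def es' split(2) by auto
  moreover have "f \<in> set es \<or> last vs \<notin> f"
  proof (cases "f = e0")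
    case False
    then have "f \<in> spare E es (hd vs)" using f(1,2,5) vs' by (simp add: spare_def)
    then show ?thesis using spare_not_closing[OF P nonham] by blast
  qed (simp add: es')
  ultimately have "nbrs E es (last vs) \<subseteq> nbrs E fs (last vs)"
    by (rule nbrs_mono_if_not_mem)
  \<comment> \<open>Either the path keeps its set of hyperedges or \<open>e0\<close> and
    \<open>f\<close> trade places. Density therefore survives, and the new first hyperedge can be
    swapped afterwards.\<close>
  moreover have "card (spare E fs (hd vs)) = card (spare E es (hd vs))"
  proof (cases "f = e0")
    case True
    then have "set fs = set es" unfolding fs_def es' split(2) by auto
    then show ?thesis by (simp add: spare_def)
  next
    case False
    then have "f \<in> spare E es u" using f by (auto simp: spare_def)
    moreover have "spare E fs u = insert e0 (spare E es u - {f})"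
      using D f L(2) False unfolding spare_def fs_def es' split(2) by auto
    moreover have "e0 \<notin> spare E es u" by (simp add: spare_def es')
    moreover have "finite (spare E es u)" using finite_edges[OF H] by (simp add: spare_def)
    ultimately show ?thesis
      using vs' card_Suc_Diff1[of "spare E es u" f] by (simp add: card_insert_if)
  qed
  moreover have "hd ws = hd vs" "last ws = last vs" "fs ! 0 = es ! i"
    using vs' split(1,8,9) ei by (auto simp: ws_def fs_def)
  moreover have "ws ! 1 = vs ! i"
    using split(8) li by (cases xs rule: rev_cases) (auto simp: ws_def)
  moreover have "?N \<subseteq> nbrs E fs (hd vs)" using f(6) vs' by (simp add: fs_def)
  ultimately show ?thesis using that Q by blast
qed

text \<open>A bad first hyperedge is swapped out directly. Otherwise the bad \<open>es ! i\<close>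
  is rotated to the front. Unless the neighbourhood has grown by then, it is swapped out there if
  \<open>vs ! i\<close> is a neighbour, and if not, the second vertex is a non-neighbour. The facts
  about \<open>i\<close> locate a crossing in the balanced case.\<close>

lemma enlarge_nbrs_or_free_second:
  assumes H: "hypergraph V E" and P: "ham_path V E vs es"
    and nonham: "\<not> hamiltonian_berge_cycle V E"
    and dense: "2 ^ card (nbrs E es (hd vs)) + 1
      \<le> card (spare E es (hd vs)) + card (nbrs E es (hd vs))"
    and snd: "vs ! 1 \<in> nbrs E es (hd vs)"
    and i: "i < length es" "hd vs \<in> es ! i" "vs ! Suc i \<in> nbrs E es (hd vs)"
    and bad: "\<not> es ! i \<subseteq> insert (hd vs) (nbrs E es (hd vs))"
  obtains ws fs where "ham_path V E ws fs" "hd ws = hd vs" "last ws = last vs"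
    "nbrs E es (hd vs) \<subseteq> nbrs E fs (hd vs)"
    "nbrs E es (last vs) \<subseteq> nbrs E fs (last vs)"
    "nbrs E es (hd vs) \<subset> nbrs E fs (hd vs) \<or>
      0 < i \<and> vs ! i \<notin> nbrs E es (hd vs) \<and> ws ! 1 \<notin> nbrs E fs (hd vs)"
proof (cases "es ! 0 \<subseteq> insert (hd vs) (nbrs E es (hd vs))")
  case False
  have "es \<noteq> []" using i(1) by auto
  then show ?thesis
    using enlarge_nbrs_swap_first[OF H P nonham dense _ snd False] that by (metis less_imp_le)
next
  case True
  then have "0 < i" using bad by (metis gr0I)
  obtain ws fs where Q: "ham_path V E ws fs" "hd ws = hd vs" "last ws = last vs"
    "ws ! 1 = vs ! i" "fs ! 0 = es ! i"
    "nbrs E es (hd vs) \<subseteq> nbrs E fs (hd vs)"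
    "nbrs E es (last vs) \<subseteq> nbrs E fs (last vs)"
    "card (spare E fs (hd vs)) = card (spare E es (hd vs))"
    by (rule rotate_edge_to_front[OF H P nonham dense snd True \<open>0 < i\<close> i])
  show ?thesis
  proof (cases "nbrs E es (hd vs) = nbrs E fs (hd vs) \<and> vs ! i \<in> nbrs E es (hd vs)")
    case False
    then show ?thesis using that[of ws fs] Q \<open>0 < i\<close> by auto
  next
    case True
    have "fs \<noteq> []" using Q(1) P i(1) ham_path_length
      by (metis distinct_card ham_path_def list.size(3) nat.inject not_less_zero)
    then obtain fs' where "ham_path V E ws fs'" "nbrs E fs (hd ws) \<subset> nbrs E fs' (hd ws)"
      "nbrs E fs (last ws) \<subseteq> nbrs E fs' (last ws)"
      using enlarge_nbrs_swap_first[OF H Q(1) nonham] dense Q True bad by metis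
    then have "nbrs E es (hd vs) \<subset> nbrs E fs' (hd vs)"
      "nbrs E es (last vs) \<subseteq> nbrs E fs' (last vs)"
      using Q True by auto
    then show ?thesis using that[OF \<open>ham_path V E ws fs'\<close> Q(2,3)] by auto
  qed
qed

section \<open>Degree surplus and the gain of a position\<close>

lemma ham_path_length_eq:
  assumes "ham_path V E vs es" "ham_path V E ws fs"
  shows "length fs = length es"
proof -
  have "length vs = card V" "length ws = card V"
    using assms distinct_card[of vs] distinct_card[of ws] by (simp_all add: ham_path_def)
  then show ?thesis
    using ham_path_length[OF assms(1)] ham_path_length[OF assms(2)] by simp
qed

text \<open>The degree counts spare and used hyperedges, and the used positions inside
  \<open>preds\<close> are at most as many as the neighbours; this gives density. By
  \<open>hdegree_le\<close> the bad positions outnumber the used ones outside \<open>preds\<close>,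
  so one of them lies in \<open>preds\<close>.\<close>

lemma dense_and_bad_edge:
  assumes H: "hypergraph V E" and P: "ham_path V E vs es"
    and deg: "2 ^ card (nbrs E es (hd vs)) + card (used es (hd vs) - preds E vs es)
      < hdegree E (hd vs)"
  shows "2 ^ card (nbrs E es (hd vs)) + 1
      \<le> card (spare E es (hd vs)) + card (nbrs E es (hd vs))"
    and "\<exists>i \<in> preds E vs es \<inter> used es (hd vs).
      \<not> es ! i \<subseteq> insert (hd vs) (nbrs E es (hd vs))"
proof -
  let ?U = "used es (hd vs)" and ?A = "preds E vs es"
  have "card ?U = card (?U \<inter> ?A) + card (?U - ?A)"
    by (rule card_Int_Diff) simp
  moreover have "card (?U \<inter> ?A) \<le> card ?A" by (rule card_mono) auto
  ultimately show "2 ^ card (nbrs E es (hd vs)) + 1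
      \<le> card (spare E es (hd vs)) + card (nbrs E es (hd vs))"
    using deg hdegree_eq[OF H P, of "hd vs"] card_preds[OF H P] by linarith
  let ?B = "{i \<in> ?U. \<not> es ! i \<subseteq> insert (hd vs) (nbrs E es (hd vs))}"
  have "card (?U - ?A) < card ?B"
    using deg hdegree_le[OF H P, of "hd vs"] by linarith
  moreover have "card ?B \<le> card (?U - ?A)" if "?B \<subseteq> ?U - ?A"
    by (rule card_mono) (use that in simp_all)
  ultimately have "\<not> ?B \<subseteq> ?U - ?A" by linarith
  then show "\<exists>i \<in> ?A \<inter> ?U. \<not> es ! i \<subseteq> insert (hd vs) (nbrs E es (hd vs))"
    by blast
qed

text \<open>Position \<open>0\<close> is always used, so \<open>sub\<close> makes
  \<open>vs ! 1\<close> a neighbour. After rerouting, either \<open>preds\<close> has grown with the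
  neighbourhood or position \<open>0\<close> is used without being in \<open>preds\<close>.\<close>

lemma larger_preds_used:
  assumes H: "hypergraph V E" and P: "ham_path V E vs es"
    and nonham: "\<not> hamiltonian_berge_cycle V E" and ne: "es \<noteq> []"
    and sub: "used es (hd vs) \<subseteq> preds E vs es"
    and deg: "2 ^ card (nbrs E es (hd vs)) < hdegree E (hd vs)"
  obtains ws fs where "ham_path V E ws fs" "hd ws = hd vs" "last ws = last vs"
    "nbrs E es (last vs) \<subseteq> nbrs E fs (last vs)"
    "card (nbrs E es (hd vs)) < card (preds E ws fs \<union> used fs (hd ws))"
proof -
  have deg': "2 ^ card (nbrs E es (hd vs)) + card (used es (hd vs) - preds E vs es)
      < hdegree E (hd vs)"
    using deg sub by (simp add: Diff_eq_empty_iff[THEN iffD2])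
  obtain i where i: "i \<in> preds E vs es" "i \<in> used es (hd vs)"
    "\<not> es ! i \<subseteq> insert (hd vs) (nbrs E es (hd vs))"
    using dense_and_bad_edge(2)[OF H P deg'] by blast
  have snd: "vs ! 1 \<in> nbrs E es (hd vs)"
    using zero_in_used[OF P ne] sub by (auto simp: preds_def)
  have i': "i < length es" "hd vs \<in> es ! i" "vs ! Suc i \<in> nbrs E es (hd vs)"
    using i by (auto simp: preds_def used_def)
  obtain ws fs where Q: "ham_path V E ws fs" "hd ws = hd vs" "last ws = last vs"
    "nbrs E es (hd vs) \<subseteq> nbrs E fs (hd vs)"
    "nbrs E es (last vs) \<subseteq> nbrs E fs (last vs)"
    "nbrs E es (hd vs) \<subset> nbrs E fs (hd vs) \<or>
      0 < i \<and> vs ! i \<notin> nbrs E es (hd vs) \<and> ws ! 1 \<notin> nbrs E fs (hd vs)"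
    by (rule enlarge_nbrs_or_free_second[OF H P nonham dense_and_bad_edge(1)[OF H P deg'] snd i' i(3)])
  have card: "card (preds E ws fs) = card (nbrs E fs (hd vs))"
    using card_preds[OF H Q(1)] Q(2) by simp
  have "card (nbrs E es (hd vs)) < card (preds E ws fs \<union> used fs (hd ws))"
  proof (cases "nbrs E es (hd vs) \<subset> nbrs E fs (hd vs)")
    case True
    then have "card (nbrs E es (hd vs)) < card (preds E ws fs)"
      unfolding card by (rule psubset_card_mono[OF finite_nbrs[OF H]])
    also have "\<dots> \<le> card (preds E ws fs \<union> used fs (hd ws))"
      by (rule card_mono) auto
    finally show ?thesis .
  next
    case False
    have "fs \<noteq> []" using ham_path_length_eq[OF P Q(1)] ne by auto
    then have "0 \<in> used fs (hd ws) - preds E ws fs"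
      using zero_in_used[OF Q(1)] Q(2,6) False by (simp add: preds_def)
    then have "preds E ws fs \<subset> preds E ws fs \<union> used fs (hd ws)" by blast
    then have "card (preds E ws fs) < card (preds E ws fs \<union> used fs (hd ws))"
      by (rule psubset_card_mono[rotated]) simp
    moreover have "card (nbrs E es (hd vs)) \<le> card (preds E ws fs)"
      unfolding card by (rule card_mono[OF finite_nbrs[OF H] Q(4)])
    ultimately show ?thesis by simp
  qed
  then show ?thesis using that Q by blast
qed

lemma used_subset_preds:
  assumes H: "hypergraph V E" and P: "ham_path V E vs es"
    and "card (preds E vs es \<union> used es (hd vs)) \<le> card (nbrs E es (hd vs))"
  shows "used es (hd vs) \<subseteq> preds E vs es"
proof -
  have "preds E vs es = preds E vs es \<union> used es (hd vs)"
    using assms(3) card_preds[OF H P]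
    by (intro card_seteq) auto
  then show ?thesis by blast
qed

text \<open>Without a Hamiltonian cycle, \<open>preds\<close> and \<open>succs\<close> fill all
  positions, so \<open>used\<close> is contained in \<open>preds\<close>. Rerouting then gains a
  position at the first end and loses no neighbour at the last, which exceeds
  \<open>length es\<close>.\<close>

lemma hamiltonian_if_nbrs_tight:
  assumes H: "hypergraph V E" and P: "ham_path V E vs es" and ne: "es \<noteq> []"
    and deg: "2 ^ card (nbrs E es (hd vs)) < hdegree E (hd vs)"
    and tight: "length es \<le> card (nbrs E es (hd vs)) + card (nbrs E es (last vs))"
  shows "hamiltonian_berge_cycle V E"
proof (rule ccontr)
  assume nonham: "\<not> ?thesis"
  have "card (preds E vs es \<union> used es (hd vs)) \<le> card (nbrs E es (hd vs))"
    using card_preds_used_le[OF H P nonham] tight by linarith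
  then have "used es (hd vs) \<subseteq> preds E vs es" by (rule used_subset_preds[OF H P])
  then obtain ws fs where Q: "ham_path V E ws fs" "last ws = last vs"
    "nbrs E es (last vs) \<subseteq> nbrs E fs (last vs)"
    "card (nbrs E es (hd vs)) < card (preds E ws fs \<union> used fs (hd ws))"
    using larger_preds_used[OF H P nonham ne _ deg] by metis
  have "card (nbrs E es (last vs)) \<le> card (nbrs E fs (last ws))"
    using card_mono[OF finite_nbrs[OF H] Q(3)] Q(2) by simp
  then show False
    using card_preds_used_le[OF H Q(1) nonham] Q(4) ham_path_length_eq[OF P Q(1)] tight
    by linarith
qed

text \<open>The cycle is \<open>v\<^sub>0 \<dots> v\<^sub>j\<close>, then \<open>v\<^sub>t\<^sub>+\<^sub>1 \<dots> v\<^sub>n\<close> (via \<open>g\<close>), then \<open>v\<^sub>j\<^sub>+\<^sub>1 \<dots> v\<^sub>t\<close> (via \<open>es ! j\<close>), closed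
  by \<open>f\<close>.\<close>

lemma hamiltonian_if_two_crossings:
  assumes P: "ham_path V E vs es" and jt: "j < t" "t < length es"
    and f: "f \<in> E" "f \<notin> set es" "hd vs \<in> f" "vs ! t \<in> f"
    and g: "g \<in> E" "g \<notin> set es" "vs ! j \<in> g" "vs ! Suc t \<in> g"
    and "f \<noteq> g" "last vs \<in> es ! j"
  shows "hamiltonian_berge_cycle V E"
proof -
  have "links vs es" "j < length es" using P jt by (auto simp: ham_path_def)
  from links_split[OF this] obtain xs ws as d bs' where
    1: "vs = xs @ ws" "es = as @ d # bs'" "es ! j = d" "length xs = Suc j" "length as = j"
      "links xs as" "links ws bs'" "last xs = vs ! j" "hd ws = vs ! Suc j" "xs \<noteq> []" "ws \<noteq> []"
    by metis
  have "t - Suc j < length bs'" using jt 1(2,5) by simp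
  from links_split[OF 1(7) this] obtain ys zs bs e cs where
    2: "ws = ys @ zs" "bs' = bs @ e # cs" "links ys bs" "links zs cs"
      "last ys = ws ! (t - Suc j)" "hd zs = ws ! Suc (t - Suc j)" "ys \<noteq> []" "zs \<noteq> []"
    by metis
  have ends: "last ys = vs ! t" "hd zs = vs ! Suc t" "hd ys = vs ! Suc j" "last zs = last vs"
  proof -
    have "ws ! k = vs ! (Suc j + k)" for k using 1(1,4) by (simp add: nth_append)
    then show "last ys = vs ! t" "hd zs = vs ! Suc t" using 2(5,6) jt(1) by auto
    show "hd ys = vs ! Suc j" using 1(9) 2(1,7) by simp
    show "last zs = last vs" using 1(1) 2(1,8) by simp
  qed
  have d: "distinct (xs @ ys @ zs)" "set (xs @ ys @ zs) = V" "distinct (as @ d # bs @ e # cs)"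
    "set (as @ d # bs @ e # cs) \<subseteq> E" "set es = set (as @ d # bs @ e # cs)"
    using P unfolding 1(1,2) 2(1,2) ham_path_def by auto
  have "hd ys \<in> d"
    using ham_path_nth(2)[OF P \<open>j < length es\<close>] ends(3) 1(3) by simp
  then have "links (zs @ ys) (cs @ d # bs)"
    using 2(3,4,7,8) ends(4) \<open>last vs \<in> es ! j\<close> 1(3)
    by (subst links_append) (auto simp: links_length)
  then have "links (xs @ zs @ ys) (as @ g # cs @ d # bs)"
    using 1(6,8) 2(7,8) g(3,4) ends(2)
    by (subst links_append) (auto simp: links_length)
  then have "ham_path V E (xs @ zs @ ys) (as @ g # cs @ d # bs)"
    using d g(1,2) by (auto simp: ham_path_def)
  moreover have "f \<notin> set (as @ g # cs @ d # bs)"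
    using f(2) d(5) \<open>f \<noteq> g\<close> by auto
  moreover have "hd (xs @ zs @ ys) \<in> f" "last (xs @ zs @ ys) \<in> f"
    using f(3,4) 1(1,10) 2(7) ends(1) by auto
  ultimately show ?thesis using f(1) by (intro hamiltonian_if_close_path)
qed

section \<open>The balanced case for even order\<close>

text \<open>The non-neighbour \<open>vs ! 1\<close> exhausts the slack, so every position after the
  first is in \<open>preds\<close> or \<open>succs\<close>. A bad hyperedge at the last vertex
  either enlarges its neighbourhood or sits at a position \<open>j\<close> with
  \<open>vs ! Suc j\<close> not adjacent to that vertex, and then two crossings close a
  cycle.\<close>

lemma balanced_case_with_free_second:
  assumes H: "hypergraph V E" and P: "ham_path V E vs es"
    and nonham: "\<not> hamiltonian_berge_cycle V E"
    and len: "length es = 2 * m + 1" and m: "4 \<le> m"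
    and card: "card (nbrs E es (hd vs)) = m" "card (nbrs E es (last vs)) = m"
    and deg: "2 ^ m + 1 < hdegree E (last vs)"
    and free: "vs ! 1 \<notin> nbrs E es (hd vs)"
  obtains ws fs where "ham_path V E ws fs" "hd ws = hd vs" "last ws = last vs"
    "nbrs E es (hd vs) \<subseteq> nbrs E fs (hd vs)" "nbrs E es (last vs) \<subset> nbrs E fs (last vs)"
proof (rule ccontr)
  assume no: "\<not> thesis"
  let ?n = "length es" and ?X = "nbrs E es (hd vs)" and ?Y = "nbrs E es (last vs)"
  let ?A = "preds E vs es" and ?B = "succs E vs es"
  have lenv: "length vs = Suc ?n" using P by (rule ham_path_length)
  have ne: "es \<noteq> []" using len by auto
  have disj: "(?A \<union> used es (hd vs)) \<inter> ?B = {}"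
    by (rule preds_used_disjnt_succs[OF P nonham])
  \<comment> \<open>Position \<open>0\<close> is used by \<open>hd vs\<close>, which excludes it
    from \<open>succs\<close>. The remaining \<open>2 * m\<close> positions are then filled
    exactly.\<close>
  have "0 \<notin> ?A" "0 \<notin> ?B"
    using free disj zero_in_used[OF P ne] by (auto simp: preds_def)
  then have "?A \<union> ?B \<subseteq> {1..<?n}"
    by (auto simp: preds_def succs_def Suc_le_eq intro: gr0I)
  moreover have "card (?A \<union> ?B) = card ?A + card ?B"
    by (rule card_Un_disjoint) (use disj in auto)
  ultimately have "?A \<union> ?B = {1..<?n}"
    using card card_preds[OF H P] card_succs[OF H P] len by (intro card_subset_eq) auto
  then have step: "vs ! Suc i \<in> ?X \<or> vs ! i \<in> ?Y" if "1 \<le> i" "i < ?n" for i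
    using that by (auto simp: preds_def succs_def set_eq_iff)
  have lastX: "vs ! ?n \<notin> ?X"
    using last_not_in_nbrs_hd[OF P nonham] ham_path_last_nth[OF P] by auto

  have R: "ham_path V E (rev vs) (rev es)" by (rule ham_path_rev[OF P])
  have vne: "vs \<noteq> []" using lenv by auto
  then have ends: "hd (rev vs) = last vs" "last (rev vs) = hd vs"
    by (auto simp: hd_rev last_rev)
  let ?A' = "preds E (rev vs) (rev es)" and ?U' = "used (rev es) (last vs)"
  \<comment> \<open>At most one used position lies outside \<open>preds\<close>, and the additional
    \<open>1\<close> in \<open>deg\<close> pays for it.\<close>
  have "card (?A' \<union> ?U') \<le> Suc m"
    using card_preds_used_le[OF H R nonham] ends card len by simp
  moreover have "card (?A' \<union> ?U') = card ?A' + card (?U' - ?A')"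
    by (subst card_Un_disjoint[symmetric]) (auto intro: arg_cong[where f = card])
  moreover have "card ?A' = m" using card_preds[OF H R] ends card by simp
  ultimately have "card (?U' - ?A') \<le> 1" by simp
  then have degR: "2 ^ card (nbrs E (rev es) (hd (rev vs)))
      + card (used (rev es) (hd (rev vs)) - preds E (rev vs) (rev es)) < hdegree E (hd (rev vs))"
    using deg card ends by simp
  note dense = dense_and_bad_edge(1)[OF H R degR]
  obtain i where i: "i \<in> ?A'" "i \<in> ?U'"
    "\<not> rev es ! i \<subseteq> insert (hd (rev vs)) (nbrs E (rev es) (hd (rev vs)))"
    using dense_and_bad_edge(2)[OF H R degR] ends by auto
  have i': "i < length (rev es)" "hd (rev vs) \<in> rev es ! i"
    "rev vs ! Suc i \<in> nbrs E (rev es) (hd (rev vs))"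
    using i ends by (auto simp: preds_def used_def)
  \<comment> \<open>The final position is not in \<open>preds\<close>, since \<open>last vs\<close>
    is no neighbour of \<open>hd vs\<close>; so it is in \<open>succs\<close>.\<close>
  have snd: "rev vs ! 1 \<in> nbrs E (rev es) (hd (rev vs))"
  proof -
    have "vs ! (?n - 1) \<in> ?Y"
      using step[of "?n - 1"] lastX len m by simp
    then show ?thesis using lenv len ends by (simp add: rev_nth)
  qed
  obtain ws fs where Q: "ham_path V E ws fs" "hd ws = hd (rev vs)" "last ws = last (rev vs)"
    "nbrs E (rev es) (hd (rev vs)) \<subseteq> nbrs E fs (hd (rev vs))"
    "nbrs E (rev es) (last (rev vs)) \<subseteq> nbrs E fs (last (rev vs))"
    "nbrs E (rev es) (hd (rev vs)) \<subset> nbrs E fs (hd (rev vs)) \<or>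
      0 < i \<and> rev vs ! i \<notin> nbrs E (rev es) (hd (rev vs)) \<and> ws ! 1 \<notin> nbrs E fs (hd (rev vs))"
    by (rule enlarge_nbrs_or_free_second[OF H R nonham dense snd i' i(3)])
  have "ws \<noteq> []" using ham_path_length[OF Q(1)] by auto
  then have "\<not> ?Y \<subset> nbrs E fs (last vs)"
    using no that[OF ham_path_rev[OF Q(1)]] Q(2-5) ends by (auto simp: hd_rev last_rev)
  then have i0: "0 < i" "rev vs ! i \<notin> ?Y" using Q(6) ends by auto

  define j where "j = ?n - Suc i"
  have j: "Suc j < ?n" "rev vs ! i = vs ! Suc j" "rev es ! i = es ! j" "rev vs ! Suc i = vs ! j"
    using i'(1) i0(1) lenv by (auto simp: j_def rev_nth Suc_diff_Suc)
  have jY: "vs ! j \<in> ?Y" "vs ! Suc j \<notin> ?Y" "last vs \<in> es ! j"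
    using i' i0 j ends by auto
  then have X2: "vs ! Suc (Suc j) \<in> ?X"
    using step[of "Suc j"] j(1) by auto
  \<comment> \<open>By maximality of \<open>t\<close>, position \<open>Suc t\<close>, if it exists,
    is not in \<open>preds\<close>, hence in \<open>succs\<close>: \<open>vs ! Suc t\<close> is then
    adjacent to \<open>last vs\<close>.\<close>
  define t where "t = Max {t. t \<le> ?n \<and> vs ! t \<in> ?X}"
  have fin: "finite {t. t \<le> ?n \<and> vs ! t \<in> ?X}" by simp
  have mem: "Suc (Suc j) \<in> {t. t \<le> ?n \<and> vs ! t \<in> ?X}" using X2 j(1) by simp
  then have "t \<in> {t. t \<le> ?n \<and> vs ! t \<in> ?X}"
    unfolding t_def using fin by (intro Max_in) auto
  then have t: "t \<le> ?n" "vs ! t \<in> ?X" by auto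
  have "Suc (Suc j) \<le> t" unfolding t_def by (rule Max_ge[OF fin mem])
  have "t < ?n" using t lastX by (metis le_neq_implies_less)
  have tmax: "vs ! k \<notin> ?X" if "t < k" "k \<le> ?n" for k
  proof
    assume "vs ! k \<in> ?X"
    then have "k \<in> {t. t \<le> ?n \<and> vs ! t \<in> ?X}" using that by simp
    then have "k \<le> t" unfolding t_def by (rule Max_ge[OF fin])
    then show False using that by simp
  qed
  have tY: "vs ! Suc t \<in> insert (last vs) ?Y"
  proof (cases "Suc t = ?n")
    case True
    then show ?thesis using ham_path_last_nth[OF P] by simp
  next
    case False
    then show ?thesis using step[of "Suc t"] tmax[of "Suc (Suc t)"] \<open>t < ?n\<close> by auto
  qed

  let ?T = "(\<lambda>f. f - {last vs}) ` spare E es (last vs)"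
  have T: "?T \<subseteq> Pow ?Y" "2 ^ card ?Y + 1 \<le> card ?T + card ?Y"
    using spare_family(1,2)[OF H, of "last vs" es] dense ends by simp_all
  \<comment> \<open>If \<open>vs ! Suc t\<close> is \<open>last vs\<close>, every spare hyperedge at
    that end contains it, and \<open>vs ! j\<close> serves as a default.\<close>
  define y where "y = (if vs ! Suc t \<in> ?Y then vs ! Suc t else vs ! j)"
  have "y \<in> ?Y" using jY by (simp add: y_def)
  then obtain G where G: "G \<in> ?T" "vs ! j \<in> G" "y \<in> G"
    using dense_family_pair[OF finite_nbrs[OF H] T _ jY(1)] card m by metis
  define g where "g = insert (last vs) G"
  have g: "g \<in> spare E es (last vs)"
    using spare_family(3)[OF H G(1)] by (simp add: g_def)
  obtain f where f: "f \<in> spare E es (hd vs)" "vs ! t \<in> f"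
    using t(2) by (auto simp: nbrs_def)
  have "f \<noteq> g" using spare_not_closing[OF P nonham f(1)] by (auto simp: g_def)
  have "hamiltonian_berge_cycle V E"
  proof (rule hamiltonian_if_two_crossings[OF P _ \<open>t < ?n\<close> _ _ _ f(2) _ _ _ _ \<open>f \<noteq> g\<close> jY(3)])
    show "j < t" using \<open>Suc (Suc j) \<le> t\<close> by simp
    show "vs ! j \<in> g" "vs ! Suc t \<in> g" using G tY by (auto simp: g_def y_def split: if_splits)
  qed (use f g in \<open>auto simp: spare_def\<close>)
  then show False using nonham by contradiction
qed

text \<open>A rerouting that keeps both ends and all their neighbours cannot add neighbours, as the
  sum of the two sizes would become tight. Hence a bad hyperedge at the first vertex can only make
  the second vertex a non-neighbour, and one at the last vertex then enlarges a neighbourhood after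
  all.\<close>

lemma hamiltonian_if_balanced:
  assumes H: "hypergraph V E" and P: "ham_path V E vs es"
    and len: "length es = 2 * m + 1" and m: "4 \<le> m"
    and card: "card (nbrs E es (hd vs)) = m" "card (nbrs E es (last vs)) = m"
    and deg: "2 ^ m + 1 < hdegree E (hd vs)" "2 ^ m + 1 < hdegree E (last vs)"
  shows "hamiltonian_berge_cycle V E"
proof (rule ccontr)
  assume nonham: "\<not> ?thesis"
  have stable: "nbrs E fs (hd vs) = nbrs E es (hd vs) \<and> nbrs E fs (last vs) = nbrs E es (last vs)"
    if Q: "ham_path V E ws fs" "hd ws = hd vs" "last ws = last vs"
      and sub: "nbrs E es (hd vs) \<subseteq> nbrs E fs (hd vs)" "nbrs E es (last vs) \<subseteq> nbrs E fs (last vs)"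
    for ws fs
  proof -
    have len': "length fs = 2 * m + 1" using ham_path_length_eq[OF P Q(1)] len by simp
    have ne: "fs \<noteq> []" "rev fs \<noteq> []" using len' by auto
    have "ws \<noteq> []" using ham_path_length[OF Q(1)] by auto
    then have ends: "hd (rev ws) = last vs" "last (rev ws) = hd vs"
      using Q by (auto simp: hd_rev last_rev)
    have ge: "m \<le> card (nbrs E fs (hd vs))" "m \<le> card (nbrs E fs (last vs))"
      using card sub card_mono[OF finite_nbrs[OF H]] by metis+
    have "card (preds E ws fs) \<le> card (preds E ws fs \<union> used fs (hd ws))"
      by (rule card_mono) auto
    then have "card (nbrs E fs (hd vs)) + card (nbrs E fs (last vs)) \<le> 2 * m + 1"
      using card_preds_used_le[OF H Q(1) nonham] card_preds[OF H Q(1)] len' Q(2,3) by simp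
    \<comment> \<open>Equality would leave one end with exactly \<open>m\<close> neighbours, so the
      tight case applies to the path or to its reversal.\<close>
    moreover have "card (nbrs E fs (hd vs)) + card (nbrs E fs (last vs)) < 2 * m + 1"
    proof (rule ccontr)
      assume big: "\<not> ?thesis"
      then consider "card (nbrs E fs (hd vs)) = m" | "card (nbrs E fs (last vs)) = m"
        using ge calculation by linarith
      then show False
      proof cases
        case 1
        then show False
          using hamiltonian_if_nbrs_tight[OF H Q(1) ne(1)] nonham deg len' Q(2,3) big by simp
      next
        case 2
        then show False
          using hamiltonian_if_nbrs_tight[OF H ham_path_rev[OF Q(1)] ne(2)] nonham deg len' ends big
          by simp
      qed
    qed
    ultimately have "card (nbrs E fs (hd vs)) = m" "card (nbrs E fs (last vs)) = m"
      using ge by linarith+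
    then show ?thesis
      using card sub card_subset_eq[OF finite_nbrs[OF H]] by metis
  qed
  have ne: "es \<noteq> []" using len by auto
  obtain ws fs where Q: "ham_path V E ws fs" "hd ws = hd vs" "last ws = last vs"
    "nbrs E fs (hd vs) = nbrs E es (hd vs)" "nbrs E fs (last vs) = nbrs E es (last vs)"
    "ws ! 1 \<notin> nbrs E fs (hd vs)"
  proof (cases "vs ! 1 \<in> nbrs E es (hd vs)")
    case False
    then show ?thesis using that[OF P] by simp
  next
    case True
    let ?A = "preds E vs es" and ?U = "used es (hd vs)"
    have "card (?A \<union> ?U) \<le> Suc m"
      using card_preds_used_le[OF H P nonham] card len by simp
    moreover have "card (?A \<union> ?U) = card ?A + card (?U - ?A)"
      by (subst card_Un_disjoint[symmetric]) (auto intro: arg_cong[where f = card])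
    moreover have "card ?A = m" using card_preds[OF H P] card by simp
    ultimately have "card (?U - ?A) \<le> 1" by simp
    then have d: "2 ^ card (nbrs E es (hd vs)) + card (?U - ?A) < hdegree E (hd vs)"
      using deg card by simp
    obtain i where i: "i \<in> ?A" "i \<in> ?U" "\<not> es ! i \<subseteq> insert (hd vs) (nbrs E es (hd vs))"
      using dense_and_bad_edge(2)[OF H P d] by auto
    have i': "i < length es" "hd vs \<in> es ! i" "vs ! Suc i \<in> nbrs E es (hd vs)"
      using i by (auto simp: preds_def used_def)
    obtain ws fs where Q: "ham_path V E ws fs" "hd ws = hd vs" "last ws = last vs"
      "nbrs E es (hd vs) \<subseteq> nbrs E fs (hd vs)"
      "nbrs E es (last vs) \<subseteq> nbrs E fs (last vs)"
      "nbrs E es (hd vs) \<subset> nbrs E fs (hd vs) \<or>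
        0 < i \<and> vs ! i \<notin> nbrs E es (hd vs) \<and> ws ! 1 \<notin> nbrs E fs (hd vs)"
      by (rule enlarge_nbrs_or_free_second[OF H P nonham dense_and_bad_edge(1)[OF H P d]
            True i' i(3)])
    then show ?thesis using that[OF Q(1-3)] stable[OF Q(1-5)] by auto
  qed
  have len': "length fs = 2 * m + 1" using ham_path_length_eq[OF P Q(1)] len by simp
  have c: "card (nbrs E fs (hd ws)) = m" "card (nbrs E fs (last ws)) = m"
    "2 ^ m + 1 < hdegree E (last ws)" "ws ! 1 \<notin> nbrs E fs (hd ws)"
    using Q card deg by simp_all
  obtain ws' fs' where Q': "ham_path V E ws' fs'" "hd ws' = hd ws" "last ws' = last ws"
    "nbrs E fs (hd ws) \<subseteq> nbrs E fs' (hd ws)" "nbrs E fs (last ws) \<subset> nbrs E fs' (last ws)"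
    by (rule balanced_case_with_free_second[OF H Q(1) nonham len' m c])
  then show False
    using stable[OF Q'(1)] Q by auto
qed

section \<open>Chvatal-type counting\<close>

text \<open>Off the path, the pair would put \<open>i\<close> into \<open>succs\<close>. On the path
  it could only be the last hyperedge, with \<open>i\<close> its position; it misses
  \<open>hd vs\<close> because \<open>length es \<ge> 2\<close>, so \<open>i\<close> would be in
  \<open>preds\<close> and the two ends adjacent.\<close>

lemma preds_used_not_adjacent_last:
  assumes P: "ham_path V E vs es" and nonham: "\<not> hamiltonian_berge_cycle V E"
    and len: "2 \<le> length es" and i: "i \<in> preds E vs es \<union> used es (hd vs)"
  shows "vs ! i \<in> V" "vs ! i \<noteq> last vs" "{vs ! i, last vs} \<notin> E"
proof -
  let ?n = "length es"
  have lenv: "length vs = Suc ?n" using P by (rule ham_path_length)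
  have d: "distinct vs" "set vs = V" using P by (auto simp: ham_path_def)
  have last: "last vs = vs ! ?n" and hd: "hd vs = vs ! 0"
    using P by (rule ham_path_last_nth, rule ham_path_hd_nth)
  have i': "i < ?n" using i by (auto simp: preds_def used_def)
  then show "vs ! i \<in> V" using d lenv nth_mem[of i vs] by simp
  show neq: "vs ! i \<noteq> last vs"
    using i' d lenv by (simp add: last nth_eq_iff_index_eq)
  show "{vs ! i, last vs} \<notin> E"
  proof
    assume e: "{vs ! i, last vs} \<in> E"
    show False
    proof (cases "{vs ! i, last vs} \<in> set es")
      case False
      then have "i \<in> succs E vs es"
        using e i' neq by (auto simp: succs_def nbrs_def spare_def)
      then show False using preds_used_disjnt_succs[OF P nonham] i by blast
    next
      case True
      then obtain k where k: "k < ?n" "es ! k = {vs ! i, last vs}"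
        by (auto simp: in_set_conv_nth)
      then have "vs ! k \<in> {vs ! i, vs ! ?n}" "vs ! Suc k \<in> {vs ! i, vs ! ?n}"
        using ham_path_nth[OF P k(1)] last by auto
      then have "k = i" "Suc k = ?n"
        using k(1) i' d lenv by (auto simp: nth_eq_iff_index_eq)
      have "vs ! 0 \<noteq> vs ! i" "vs ! 0 \<noteq> vs ! ?n"
        using \<open>k = i\<close> \<open>Suc k = ?n\<close> len d lenv by (auto simp: nth_eq_iff_index_eq)
      then have "i \<notin> used es (hd vs)"
        using k \<open>k = i\<close> by (auto simp: used_def last hd)
      then have "last vs \<in> nbrs E es (hd vs)"
        using i \<open>k = i\<close> \<open>Suc k = ?n\<close> by (auto simp: preds_def last)
      then show False using last_not_in_nbrs_hd[OF P nonham] by blast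
    qed
  qed
qed

text \<open>A vertex whose pair with \<open>last vs\<close> is missing competes with
  \<open>hd vs\<close> for the maximal degree sum, so its degree is at most that of
  \<open>hd vs\<close>.\<close>

lemma card_low_degree_ge:
  assumes H: "hypergraph V E" and P: "ham_path V E vs es"
    and nonham: "\<not> hamiltonian_berge_cycle V E" and len: "2 \<le> length es"
    and max: "\<And>x y. x \<in> V \<Longrightarrow> y \<in> V \<Longrightarrow> x \<noteq> y \<Longrightarrow> {x, y} \<notin> E \<Longrightarrow>
      hdegree E x + hdegree E y \<le> hdegree E (hd vs) + hdegree E (last vs)"
  shows "card (preds E vs es \<union> used es (hd vs))
    \<le> card {w \<in> V. hdegree E w \<le> hdegree E (hd vs)}"
proof -
  let ?A = "preds E vs es \<union> used es (hd vs)"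
  have "distinct vs" "length vs = Suc (length es)"
    using P ham_path_length by (auto simp: ham_path_def)
  then have "inj_on (\<lambda>i. vs ! i) ?A"
    by (auto simp: inj_on_def nth_eq_iff_index_eq preds_def used_def)
  then have "card ?A = card ((\<lambda>i. vs ! i) ` ?A)" by (simp add: card_image)
  also have "\<dots> \<le> card {w \<in> V. hdegree E w \<le> hdegree E (hd vs)}"
  proof (rule card_mono)
    have "es \<noteq> []" using len by auto
    then have "last vs \<in> V" by (rule ham_path_ends(2)[OF P])
    then show "(\<lambda>i. vs ! i) ` ?A \<subseteq> {w \<in> V. hdegree E w \<le> hdegree E (hd vs)}"
      using preds_used_not_adjacent_last[OF P nonham len] max by fastforce
  qed (use H in \<open>simp add: hypergraph_def\<close>)
  finally show ?thesis .
qed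

text \<open>With \<open>p\<close> and \<open>a\<close> as in the proof, the degree of
  \<open>hd vs\<close> is at most \<open>2 ^ p + a\<close>, while the scarcity of low degrees forces
  it above \<open>2 ^ min a m\<close>. These clash unless \<open>a = p\<close> or
  \<open>p = m\<close>, where rerouting is called in.\<close>

lemma hamiltonian_if_maximal_path:
  assumes H: "hypergraph V E" and P: "ham_path V E vs es"
    and n: "card V = n" "40 < n"
    and few: "\<And>i. 1 \<le> i \<Longrightarrow> i \<le> (n - 1) div 2 \<Longrightarrow> card {w \<in> V. hdegree E w \<le> 2 ^ i} < i"
    and few_even: "even n \<Longrightarrow>
      card {w \<in> V. hdegree E w \<le> 2 ^ ((n - 1) div 2) + 1} < (n - 1) div 2"
    and max: "\<And>x y. x \<in> V \<Longrightarrow> y \<in> V \<Longrightarrow> x \<noteq> y \<Longrightarrow> {x, y} \<notin> E \<Longrightarrow>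
      hdegree E x + hdegree E y \<le> hdegree E (hd vs) + hdegree E (last vs)"
    and le: "card (nbrs E es (hd vs)) \<le> card (nbrs E es (last vs))"
  shows "hamiltonian_berge_cycle V E"
proof (rule ccontr)
  assume nonham: "\<not> ?thesis"
  define m where "m = (n - 1) div 2"
  have m: "20 \<le> m" "n - 1 \<le> 2 * m + 1" using n(2) by (auto simp: m_def)
  have len: "length es = n - 1"
    using P n(1) ham_path_length[OF P] distinct_card[of vs] by (simp add: ham_path_def)
  have ne: "es \<noteq> []" using len n(2) by auto
  let ?u = "hd vs"
  define p q a where "p = card (nbrs E es (hd vs))" and "q = card (nbrs E es (last vs))"
    and "a = card (preds E vs es \<union> used es (hd vs))"
  \<comment> \<open>The bound concerns \<open>hd vs\<close> alone, so positions gained on any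
    rerouting with the same ends count.\<close>
  have low: "k \<le> card {w \<in> V. hdegree E w \<le> hdegree E ?u}"
    if "ham_path V E ws fs" "hd ws = ?u" "last ws = last vs"
      "k \<le> card (preds E ws fs \<union> used fs (hd ws))" for ws fs k
  proof -
    have "2 \<le> length fs" using ham_path_length_eq[OF P that(1)] len n(2) by simp
    then show ?thesis
      using card_low_degree_ge[OF H that(1) nonham] max that(2-4) by (metis le_trans)
  qed
  have deg_gt: "c < d"
    if "k \<le> card {w \<in> V. hdegree E w \<le> d}" "card {w \<in> V. hdegree E w \<le> c} < k" for c d k
  proof (rule ccontr)
    assume "\<not> c < d"
    then have "card {w \<in> V. hdegree E w \<le> d} \<le> card {w \<in> V. hdegree E w \<le> c}"
      using H by (intro card_mono) (auto simp: hypergraph_def)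
    then show False using that by linarith
  qed
  have key: "2 ^ k < hdegree E ?u"
    if "ham_path V E ws fs" "hd ws = ?u" "last ws = last vs"
      "k \<le> card (preds E ws fs \<union> used fs (hd ws))" "1 \<le> k" "k \<le> m" for ws fs k
    using deg_gt[OF low[OF that(1-4)] few] that(5,6) by (simp add: m_def)
  have pa: "p \<le> a"
    unfolding p_def a_def card_preds[OF H P, symmetric] by (rule card_mono) auto
  have aq: "a + q \<le> n - 1"
    using card_preds_used_le[OF H P nonham] len by (simp add: a_def q_def)
  have pq: "p \<le> q" using le by (simp add: p_def q_def)
  then have pm: "p \<le> m" using pa aq m by linarith
  have a1: "1 \<le> a"
    using zero_in_used[OF P ne] by (auto simp: a_def Suc_le_eq card_gt_0_iff)
  have "card {i \<in> used es ?u. \<not> es ! i \<subseteq> insert ?u (nbrs E es ?u)}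
      \<le> card (preds E vs es \<union> used es ?u)"
    by (rule card_mono) auto
  then have deg_le: "hdegree E ?u \<le> 2 ^ p + a"
    using hdegree_le[OF H P, of ?u] by (simp add: p_def a_def)
  have grow: "k + 1 \<le> 2 ^ k" for k :: nat
    using less_exp[of k] by linarith
  show False
  proof (cases "p < m")
    case True
    show False
    proof (cases "a = p")
      case True
      have dp: "2 ^ p < hdegree E ?u"
        using key[OF P refl refl, of p] a1 True \<open>p < m\<close> by (simp add: a_def)
      have "used es ?u \<subseteq> preds E vs es"
        using True by (intro used_subset_preds[OF H P]) (simp add: a_def p_def)
      then obtain ws fs where Q: "ham_path V E ws fs" "hd ws = hd vs" "last ws = last vs"
        "card (nbrs E es (hd vs)) < card (preds E ws fs \<union> used fs (hd ws))"
        using larger_preds_used[OF H P nonham ne] dp unfolding p_def by metis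
      \<comment> \<open>\<open>2 ^ Suc p\<close> is at least \<open>2 ^ p + p + 1\<close>, above the
        upper bound \<open>2 ^ p + a\<close>.\<close>
      have "2 ^ Suc p < hdegree E ?u"
        using key[OF Q(1-3), of "Suc p"] Q(4) \<open>p < m\<close> by (simp add: p_def)
      then show False using deg_le True grow[of p] by simp
    next
      case False
      then have ap: "p + 1 \<le> a" using pa by simp
      show False
      proof (cases "a \<le> m")
        case True
        have "(2::nat) ^ p \<le> 2 ^ (a - 1)" using ap by (intro power_increasing) auto
        moreover have "(2::nat) ^ a = 2 * 2 ^ (a - 1)"
          using a1 by (metis Suc_diff_1 Suc_le_eq One_nat_def power_Suc)
        moreover have "2 ^ a < hdegree E ?u"
          using key[OF P refl refl, of a] a1 True by (simp add: a_def)
        moreover have "a \<le> 2 ^ (a - 1)" using grow[of "a - 1"] a1 by simp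
        ultimately show False using deg_le by linarith
      next
        case False
        have "(2::nat) ^ p \<le> 2 ^ (m - 1)" using \<open>p < m\<close> by (intro power_increasing) auto
        moreover have "(2::nat) ^ m = 2 * 2 ^ (m - 1)"
          using m(1) power_Suc[of "2::nat" "m - 1"] by simp
        moreover have "2 ^ m < hdegree E ?u"
          using key[OF P refl refl, of m] False m(1) by (simp add: a_def)
        \<comment> \<open>Here \<open>a\<close> may reach \<open>2 * m + 1\<close>; the induction
          starts at \<open>m = 20\<close>, the least value allowed by \<open>n > 40\<close>.\<close>
        moreover have "2 * m + 1 \<le> 2 ^ (m - 1)"
        proof -
          have "2 * (k + 20) + 1 \<le> (2::nat) ^ (k + 19)" for k
            by (induction k) (auto simp: power_add)
          from this[of "m - 20"] show ?thesis using m(1) by simp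
        qed
        ultimately show False using deg_le aq m(2) by linarith
      qed
    qed
  next
    case False
    then have p: "p = m" using pm by simp
    have dp: "2 ^ p < hdegree E ?u"
      using key[OF P refl refl, of m] pa p m(1) by (simp add: a_def)
    show False
    proof (cases "n - 1 \<le> p + q")
      case True
      then show False
        using hamiltonian_if_nbrs_tight[OF H P ne] dp nonham len by (simp add: p_def q_def)
    next
      case False
      \<comment> \<open>\<open>2 * m < n - 1 \<le> 2 * m + 1\<close> leaves a single spare position
        and makes \<open>n\<close> even.\<close>
      then have q: "q = m" and len': "length es = 2 * m + 1"
        using p pq m len by auto
      then have "even n" using len n(2) by presburger
      note fe = few_even[OF this, folded m_def]
      have d1: "2 ^ m + 1 < hdegree E ?u"
        using deg_gt[OF low[OF P refl refl] fe] pa p by (simp add: a_def)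
      have R: "ham_path V E (rev vs) (rev es)" by (rule ham_path_rev[OF P])
      have "vs \<noteq> []" using ham_path_length[OF P] by auto
      then have ends: "hd (rev vs) = last vs" "last (rev vs) = hd vs"
        by (auto simp: hd_rev last_rev)
      have "card (preds E (rev vs) (rev es))
          \<le> card (preds E (rev vs) (rev es) \<union> used (rev es) (hd (rev vs)))"
        by (rule card_mono) auto
      also have "\<dots> \<le> card {w \<in> V. hdegree E w \<le> hdegree E (hd (rev vs))}"
        by (rule card_low_degree_ge[OF H R nonham])
          (use len n(2) max ends in \<open>auto simp: add.commute\<close>)
      finally have "m \<le> card {w \<in> V. hdegree E w \<le> hdegree E (last vs)}"
        using card_preds[OF H R] ends q by (simp add: q_def)
      then have d2: "2 ^ m + 1 < hdegree E (last vs)"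
        by (rule deg_gt[OF _ fe])
      show False
        using hamiltonian_if_balanced[OF H P len' _ _ _ d1 d2] m(1) p q nonham
        by (simp add: p_def q_def)
    qed
  qed
qed

section \<open>Saturated hypergraphs, missing pairs and degree sequences\<close>

text \<open>The cycle must use \<open>h\<close>; removing \<open>h\<close> leaves a Hamiltonian path
  between \<open>u\<close> and \<open>v\<close>, oriented by reversal if necessary.\<close>

lemma ham_path_of_cycle_through:
  assumes C: "berge_cycle (insert h E) vs es" "set vs = V" "2 \<le> card V"
    and nonham: "\<not> hamiltonian_berge_cycle V E" and h: "h = {u, v}"
  obtains ws fs where "ham_path V E ws fs" "hd ws = u" "last ws = v"
proof -
  have C': "length vs = length es" "distinct vs" "distinct es" "set es \<subseteq> insert h E"
    "\<And>i. i < length vs \<Longrightarrow> {vs ! i, vs ! ((i + 1) mod length vs)} \<subseteq> es ! i"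
    using C(1) by (auto simp: berge_cycle_def)
  have n: "2 \<le> length vs" using C(2,3) C'(2) distinct_card by metis
  then have vne: "vs \<noteq> []" by auto
  have "h \<in> set es"
  proof (rule ccontr)
    assume "h \<notin> set es"
    then have "berge_cycle E vs es" using C(1) by (auto simp: berge_cycle_def)
    then show False using nonham C(2) by (auto simp: hamiltonian_berge_cycle_def)
  qed
  then obtain k where k: "k < length es" "es ! k = h" by (auto simp: in_set_conv_nth)
  \<comment> \<open>Repeating the first vertex turns the cycle into a closed walk, to be cut at
    \<open>h\<close> and glued together at that vertex.\<close>
  have "links (vs @ [hd vs]) es"
    unfolding links_iff_nth
  proof (intro conjI allI impI)
    fix i assume i: "i < length es"
    show "(vs @ [hd vs]) ! i \<in> es ! i"
      using C'(1) C'(5)[of i] i by (simp add: nth_append)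
    have "(vs @ [hd vs]) ! Suc i = vs ! ((i + 1) mod length vs)"
    proof (cases "Suc i = length vs")
      case True
      then show ?thesis using vne by (simp add: nth_append hd_conv_nth)
    next
      case False
      then show ?thesis using i C'(1) by (simp add: nth_append)
    qed
    then show "(vs @ [hd vs]) ! Suc i \<in> es ! i"
      using C'(1) C'(5)[of i] i by simp
  qed (use C'(1) in simp)
  from links_split[OF this k(1)] obtain xs ys as e bs where
    s: "vs @ [hd vs] = xs @ ys" "es = as @ e # bs" "es ! k = e" "links xs as" "links ys bs"
      "last xs = (vs @ [hd vs]) ! k" "hd ys = (vs @ [hd vs]) ! Suc k" "xs \<noteq> []" "ys \<noteq> []"
    by metis
  define zs where "zs = butlast ys"
  have ys: "ys = zs @ [hd vs]" and vs: "vs = xs @ zs"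
    using s(1,9) by (metis zs_def append_butlast_last_id last_appendR last_snoc,
        metis zs_def butlast_append butlast_snoc)
  have xs: "xs = hd vs # tl xs" using vs s(8) by simp
  have "links (zs @ xs) (bs @ as)"
    using links_glue[of zs "hd vs" bs "tl xs" as] s(4,5) ys xs by simp
  then have Q: "ham_path V E (zs @ xs) (bs @ as)"
    using C(2) C'(2-4) vs s(2) k(2) s(3) by (auto simp: ham_path_def)
  have "links (vs @ [hd vs]) es" by fact
  then have "last xs \<in> h" "hd ys \<in> h"
    using links_nth[OF _ k(1)] s(6,7) k(2) by auto
  moreover have "hd ys = hd (zs @ xs)"
    using ys xs by (cases zs) (auto, metis list.sel(1))
  ultimately have ends: "hd (zs @ xs) \<in> {u, v}" "last (zs @ xs) \<in> {u, v}"
    using h s(8) by auto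
  have "bs @ as \<noteq> []" using n C'(1) s(2) by auto
  then have neq: "hd (zs @ xs) \<noteq> last (zs @ xs)" by (rule ham_path_ends(3)[OF Q])
  show ?thesis
  proof (cases "hd (zs @ xs) = u")
    case True
    then show ?thesis using that[OF Q] ends neq by auto
  next
    case False
    have "zs @ xs \<noteq> []" using s(8) by simp
    then have "hd (rev (zs @ xs)) = last (zs @ xs)" "last (rev (zs @ xs)) = hd (zs @ xs)"
      by (simp_all only: hd_rev last_rev)
    then show ?thesis using that[OF ham_path_rev[OF Q]] ends neq False by auto
  qed
qed

text \<open>Consecutive pairs in any listing of \<open>V\<close> form the cycle;
  \<open>3 \<le> card V\<close> keeps the closing pair distinct from the others.\<close>

lemma hamiltonian_if_all_pairs:
  assumes "finite V" "3 \<le> card V"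
    and pairs: "\<And>x y. x \<in> V \<Longrightarrow> y \<in> V \<Longrightarrow> x \<noteq> y \<Longrightarrow> {x, y} \<in> E"
  shows "hamiltonian_berge_cycle V E"
proof -
  obtain vs where vs: "set vs = V" "distinct vs"
    using finite_distinct_list[OF assms(1)] by blast
  define n where "n = length vs - 1"
  have n: "length vs = Suc n" "2 \<le> n"
    using assms(2) vs distinct_card[of vs] by (auto simp: n_def)
  let ?e = "\<lambda>i. {vs ! i, vs ! Suc i}"
  let ?es = "map ?e [0..<n]"
  have nth: "vs ! i = vs ! j \<longleftrightarrow> i = j" if "i \<le> n" "j \<le> n" for i j
    using that n vs(2) by (simp add: nth_eq_iff_index_eq)
  have mem: "vs ! i \<in> V" if "i \<le> n" for i
    using that n vs(1) nth_mem[of i vs] by simp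
  have "inj_on ?e {0..<n}"
    by (rule inj_onI) (auto simp: doubleton_eq_iff nth)
  then have P: "ham_path V E vs ?es"
    using vs n by (auto simp: ham_path_def distinct_map links_iff_nth nth mem intro!: pairs)
  have "vs \<noteq> []" using n by auto
  then have ends: "hd vs = vs ! 0" "last vs = vs ! n"
    using n by (simp_all add: hd_conv_nth last_conv_nth)
  show ?thesis
  proof (rule hamiltonian_if_close_path[OF P])
    show "{vs ! 0, vs ! n} \<in> E"
      using n by (intro pairs) (auto simp: nth mem)
    show "{vs ! 0, vs ! n} \<notin> set ?es"
      using n by (auto simp: doubleton_eq_iff nth)
  qed (use ends in auto)
qed

text \<open>Only the \<open>i - 1\<close> entries preceding the \<open>i\<close>-th one in sorted
  order can be at most \<open>c\<close>.\<close>

lemma card_le_if_nth_sorted_gt: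
  assumes V: "finite V" and i: "1 \<le> i" "i \<le> card V" and c: "c < sdeg V E i"
  shows "card {w \<in> V. hdegree E w \<le> c} < i"
proof -
  define L where "L = degree_seq V E"
  have L: "mset L = image_mset (hdegree E) (mset_set V)" "sorted L"
    by (simp_all add: L_def degree_seq_def)
  have lenL: "length L = card V"
    using arg_cong[OF L(1), of size] by simp
  have "card {w \<in> V. hdegree E w \<le> c} = size (filter_mset (\<lambda>d. d \<le> c) (mset L))"
    using V by (simp add: L(1) filter_mset_image_mset)
  also have "\<dots> = length (filter (\<lambda>d. d \<le> c) L)"
    by (metis mset_filter size_mset)
  also have "\<dots> = length (filter (\<lambda>d. d \<le> c) (take (i - 1) L @ drop (i - 1) L))"
    by simp
  also have "\<dots> \<le> i - 1"
  proof -
    have "filter (\<lambda>d. d \<le> c) (drop (i - 1) L) = []"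
    proof (rule filter_False, rule ballI)
      fix d assume "d \<in> set (drop (i - 1) L)"
      then obtain k where "k < length (drop (i - 1) L)" "d = drop (i - 1) L ! k"
        by (metis in_set_conv_nth)
      then have "L ! (i - 1) \<le> d"
        using L(2) by (simp add: sorted_nth_mono)
      then show "\<not> d \<le> c" using c by (simp add: sdeg_def L_def)
    qed
    then show ?thesis
      using length_filter_le[of "\<lambda>d. d \<le> c" "take (i - 1) L"]
      by (simp only: filter_append) simp
  qed
  finally show ?thesis using i(1) by linarith
qed

theorem theorem1p5:
  fixes V :: "'a set" and E :: "'a set set" and n :: nat
  assumes "hypergraph V E"
    and "card V = n"
    and "n > 40"
    and "\<forall>i. 1 \<le> i \<and> i \<le> (n - 1) div 2 \<longrightarrow> sdeg V E i > 2 ^ i"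
    and "even n \<longrightarrow> sdeg V E ((n - 2) div 2) > 2 ^ ((n - 2) div 2) + 1"
  shows "hamiltonian_berge_cycle V E"
proof (rule ccontr)
  assume nonham: "\<not> ?thesis"
  have finV: "finite V" using assms(1) by (simp add: hypergraph_def)
  \<comment> \<open>A maximal member \<open>F\<close> of \<open>S\<close> becomes Hamiltonian as
    soon as a missing pair is added.\<close>
  define S where "S = {F. F \<subseteq> Pow V \<and> E \<subseteq> F \<and> \<not> hamiltonian_berge_cycle V F}"
  have "finite S"
    unfolding S_def by (rule finite_subset[of _ "Pow (Pow V)"]) (use finV in auto)
  moreover have "E \<in> S"
    using assms(1) nonham by (auto simp: S_def hypergraph_def)
  ultimately obtain F where F: "F \<in> S" "\<And>G. G \<in> S \<Longrightarrow> F \<subseteq> G \<Longrightarrow> F = G"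
    using finite_has_maximal2[of S E] by metis
  have H: "hypergraph V F" and EF: "E \<subseteq> F" and nonhamF: "\<not> hamiltonian_berge_cycle V F"
    using F(1) finV by (auto simp: S_def hypergraph_def)
  \<comment> \<open>Adding hyperedges only raises degrees, so the bounds on low-degree vertices pass
    from \<open>E\<close> to \<open>F\<close>.\<close>
  have mono: "hdegree E w \<le> hdegree F w" for w
    unfolding hdegree_def using EF finite_edges[OF H] by (intro card_mono) auto
  have few: "card {w \<in> V. hdegree F w \<le> c} < i"
    if "1 \<le> i" "i \<le> (n - 1) div 2" "c < sdeg V E i" for c i
  proof -
    have "card {w \<in> V. hdegree F w \<le> c} \<le> card {w \<in> V. hdegree E w \<le> c}"
      using finV mono by (intro card_mono) (auto intro: le_trans)
    also have "\<dots> < i"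
      using that assms(2,3) by (intro card_le_if_nth_sorted_gt[OF finV]) auto
    finally show ?thesis .
  qed
  \<comment> \<open>A missing pair of largest degree sum will provide the ends of the path.\<close>
  define M where "M = {(x, y). x \<in> V \<and> y \<in> V \<and> x \<noteq> y \<and> {x, y} \<notin> F}"
  define w where "w = (\<lambda>(x, y). hdegree F x + hdegree F y)"
  have "finite M" unfolding M_def by (rule finite_subset[of _ "V \<times> V"]) (use finV in auto)
  moreover have "M \<noteq> {}"
    using hamiltonian_if_all_pairs[OF finV, of F] assms(2,3) nonhamF by (auto simp: M_def)
  ultimately have "Max (w ` M) \<in> w ` M" "\<And>z. z \<in> M \<Longrightarrow> w z \<le> Max (w ` M)"
    by (auto intro: Max_in)
  then obtain u v where uv: "(u, v) \<in> M" "\<And>z. z \<in> M \<Longrightarrow> w z \<le> w (u, v)"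
    by (metis imageE surj_pair)
  have "insert {u, v} F \<notin> S" using F(2)[of "insert {u, v} F"] uv(1) by (auto simp: M_def)
  then have "hamiltonian_berge_cycle V (insert {u, v} F)"
    using F(1) uv(1) by (auto simp: S_def M_def)
  then obtain vs0 es0 where C: "berge_cycle (insert {u, v} F) vs0 es0" "set vs0 = V"
    by (auto simp: hamiltonian_berge_cycle_def)
  have "2 \<le> card V" using assms(2,3) by simp
  then obtain vs es where P: "ham_path V F vs es" "hd vs = u" "last vs = v"
    using ham_path_of_cycle_through[OF C _ nonhamF refl] by blast
  have max: "hdegree F x + hdegree F y \<le> hdegree F u + hdegree F v"
    if "x \<in> V" "y \<in> V" "x \<noteq> y" "{x, y} \<notin> F" for x y
    using uv(2)[of "(x, y)"] that by (simp add: M_def w_def)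
  have few1: "card {w \<in> V. hdegree F w \<le> 2 ^ i} < i" if "1 \<le> i" "i \<le> (n - 1) div 2" for i
    using few that assms(4) by blast
  have few2: "card {w \<in> V. hdegree F w \<le> 2 ^ ((n - 1) div 2) + 1} < (n - 1) div 2" if "even n"
  proof -
    have "(n - 2) div 2 = (n - 1) div 2" using that assms(3) by presburger
    then have "2 ^ ((n - 1) div 2) + 1 < sdeg V E ((n - 1) div 2)"
      using assms(5) that by metis
    moreover have "1 \<le> (n - 1) div 2" using assms(3) by linarith
    ultimately show ?thesis using few by blast
  qed
  have "hamiltonian_berge_cycle V F"
  \<comment> \<open>The path is oriented so that its first vertex has at most as many neighbours as
    its last.\<close>
  proof (cases "card (nbrs F es u) \<le> card (nbrs F es v)")
    case True
    then show ?thesis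
      using hamiltonian_if_maximal_path[OF H P(1) assms(2,3) few1 few2] max P(2,3) by simp
  next
    case False
    have "vs \<noteq> []" using ham_path_length[OF P(1)] by auto
    then have "hd (rev vs) = v" "last (rev vs) = u" using P(2,3) by (auto simp: hd_rev last_rev)
    then show ?thesis
      using hamiltonian_if_maximal_path[OF H ham_path_rev[OF P(1)] assms(2,3) few1 few2] max False
      by (simp add: add.commute)
  qed
  then show False using nonhamF by contradiction
qed

end
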